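(* Let $\mathcal{H}$ be a separable complex Hilbert space, let $\{e_k\}_{k=1}^\infty$ be an orthonormal basis for $\mathcal{H}$, and let $r,t\in\mathbb{R}$ with $r+t=1$. Two Bessel sequences $F=\{f_k\}_{k=1}^\infty$ and $G=\{g_k\}_{k=1}^\infty$ in $\mathcal{H}$ form a biframe $(F,G)$ for $\mathcal{H}$ if and only if there exist operators $Q\in B^{+}_{b.b.}(\mathcal{H})$ and $T,W\in B(\mathcal{H})$ such that $TW^*=I$ and, for all $k\in\mathbb{N}$, $f_k=Q^{r}We_k$ and $g_k=Q^{t}Te_k$.
   Context: A pair $(\{f_k\}_{k=1}^\infty,\{g_k\}_{k=1}^\infty)$ of sequences in $\mathcal{H}$ is a biframe for $\mathcal{H}$ if there exist constants $A,B>0$ such that $A\|f\|^2\le\sum_{k=1}^\infty\langle f,f_k\rangle\langle g_k,f\rangle\le B\|f\|^2$ for all $f\in\mathcal{H}$. A sequence $\{f_k\}$ is a Bessel sequence if there is $B>0$ with $\sum_k|\langle f,f_k\rangle|^2\le B\|f\|^2$ for all $f$. $B(\mathcal{H})$ is the set of bounded linear operators on $\mathcal{H}$, $I$ the identity, and $B^{+}_{b.b.}(\mathcal{H})$ the set of bounded, self-adjoint, positive operators on $\mathcal{H}$ that are bounded below ($\exists\alpha>0$: $\alpha\|f\|\le\|Qf\|$ for all $f$); real powers of such operators are defined by functional calculus. The inner product is linear in the first variable. *)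

theory Defs
  imports "HOL-Analysis.Analysis" "HOL-Computational_Algebra.Polynomial"
begin

text \<open>
  Complex inner product spaces are built on top of \<^class>\<open>real_normed_vector\<close>, with a complex
  scalar multiplication extending the real one. The inner product is linear in its first argument.
  The last axiom says at once that it is positive definite and that the norm is the induced one.
\<close>

class complex_vector = real_vector +
  fixes scaleC :: "complex \<Rightarrow> 'a \<Rightarrow> 'a" (infixr \<open>*\<^sub>C\<close> 75)
  assumes scaleC_add_right: "a *\<^sub>C (x + y) = a *\<^sub>C x + a *\<^sub>C y"
    and scaleC_add_left: "(a + b) *\<^sub>C x = a *\<^sub>C x + b *\<^sub>C x"
    and scaleC_scaleC: "a *\<^sub>C (b *\<^sub>C x) = (a * b) *\<^sub>C x"
    and scaleC_of_real: "complex_of_real s *\<^sub>C x = s *\<^sub>R x"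

lemma vector_space_scaleC: "vector_space (scaleC :: complex \<Rightarrow> 'a \<Rightarrow> 'a::complex_vector)"
proof
  show "1 *\<^sub>C x = x" for x :: 'a
    using scaleC_of_real[of 1 x] by simp
qed (simp_all add: scaleC_add_right scaleC_add_left scaleC_scaleC)

class complex_inner = real_normed_vector + complex_vector +
  fixes cinner :: "'a \<Rightarrow> 'a \<Rightarrow> complex"
  assumes cinner_commute: "cinner x y = cnj (cinner y x)"
    and cinner_add_left: "cinner (x + y) z = cinner x z + cinner y z"
    and cinner_scaleC_left: "cinner (a *\<^sub>C x) y = a * cinner x y"
    and cinner_self: "cinner x x = complex_of_real ((norm x)\<^sup>2)"

class chilbert_space = complex_inner + complete_space

subclass (in chilbert_space) banach ..

definition orthonormal_basis :: "(nat \<Rightarrow> 'a::chilbert_space) \<Rightarrow> bool" where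
  "orthonormal_basis e \<longleftrightarrow>
     (\<forall>j k. cinner (e j) (e k) = (if j = k then 1 else 0)) \<and>
     closure (module.span scaleC (range e)) = UNIV"

definition bessel_sequence :: "(nat \<Rightarrow> 'a::chilbert_space) \<Rightarrow> bool" where
  "bessel_sequence F \<longleftrightarrow>
     (\<exists>B>0. \<forall>f. summable (\<lambda>k. (cmod (cinner f (F k)))\<^sup>2) \<and>
                (\<Sum>k. (cmod (cinner f (F k)))\<^sup>2) \<le> B * (norm f)\<^sup>2)"

text \<open>
  The inequalities in the definition of a biframe compare a series of complex numbers with real
  ones, so they include that the series converges and that its sum is real.
\<close>

definition biframe :: "(nat \<Rightarrow> 'a::chilbert_space) \<Rightarrow> (nat \<Rightarrow> 'a) \<Rightarrow> bool" where
  "biframe F G \<longleftrightarrow>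
     (\<exists>A>0. \<exists>B>0. \<forall>f. \<exists>s::real.
        (\<lambda>k. cinner f (F k) * cinner (G k) f) sums complex_of_real s \<and>
        A * (norm f)\<^sup>2 \<le> s \<and> s \<le> B * (norm f)\<^sup>2)"

definition bounded_clinear :: "('a::complex_inner \<Rightarrow> 'b::complex_inner) \<Rightarrow> bool" where
  "bounded_clinear T \<longleftrightarrow> bounded_linear T \<and> (\<forall>c x. T (c *\<^sub>C x) = c *\<^sub>C T x)"

text \<open>Uniquely determined for bounded operators between Hilbert spaces.\<close>

definition cadjoint :: "('a::chilbert_space \<Rightarrow> 'b::chilbert_space) \<Rightarrow> 'b \<Rightarrow> 'a" where
  "cadjoint T = (THE V. \<forall>x y. cinner (T x) y = cinner x (V y))"

definition pos_bounded_below :: "('a::chilbert_space \<Rightarrow> 'a) \<Rightarrow> bool" where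
  "pos_bounded_below Q \<longleftrightarrow>
     bounded_clinear Q \<and> cadjoint Q = Q \<and>
     (\<forall>f. cinner (Q f) f \<in> \<real>\<^sub>\<ge>\<^sub>0) \<and>
     (\<exists>\<alpha>>0. \<forall>f. \<alpha> * norm f \<le> norm (Q f))"

definition op_spectrum :: "('a::chilbert_space \<Rightarrow> 'a) \<Rightarrow> complex set" where
  "op_spectrum Q =
     {z. \<not> (\<exists>R. bounded_clinear R \<and>
               R \<circ> (\<lambda>x. Q x - z *\<^sub>C x) = id \<and> (\<lambda>x. Q x - z *\<^sub>C x) \<circ> R = id)}"

definition poly_op :: "complex poly \<Rightarrow> ('a::chilbert_space \<Rightarrow> 'a) \<Rightarrow> 'a \<Rightarrow> 'a" where
  "poly_op p Q x = (\<Sum>i\<le>degree p. coeff p i *\<^sub>C (Q ^^ i) x)"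

text \<open>
  Continuous functional calculus of a bounded self-adjoint operator \<open>Q\<close>, for functions \<open>h\<close>
  continuous on its spectrum: the continuous extension of the polynomial calculus, that is, the
  operator norm limit of \<open>P n\<close> evaluated at \<open>Q\<close>, for polynomials \<open>P n\<close> converging to \<open>h\<close> uniformly
  on the spectrum. Polynomials in \<open>z\<close> alone suffice because that spectrum is real.
\<close>

definition functional_calculus ::
    "('a::chilbert_space \<Rightarrow> 'a) \<Rightarrow> (complex \<Rightarrow> complex) \<Rightarrow> 'a \<Rightarrow> 'a" where
  "functional_calculus Q h =
     (THE S. bounded_clinear S \<and>
        (\<exists>P. uniform_limit (op_spectrum Q) (\<lambda>n. poly (P n)) h sequentially \<and>
             (\<lambda>n. onorm (\<lambda>x. poly_op (P n) Q x - S x)) \<longlonglongrightarrow> 0))"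

text \<open>
  Intended for \<open>Q\<close> positive and bounded below: its spectrum then lies in the positive reals,
  where the principal branch \<open>z powr r\<close> is the usual real power.
\<close>

definition op_powr :: "('a::chilbert_space \<Rightarrow> 'a) \<Rightarrow> real \<Rightarrow> 'a \<Rightarrow> 'a" where
  "op_powr Q r = functional_calculus Q (\<lambda>z. z powr complex_of_real r)"

end

theory Submission
  imports Defs "HOL-Computational_Algebra.Fundamental_Theorem_Algebra"
begin

text \<open>
  Let \<open>C\<^sub>F f = (\<Sum>k. \<langle>f, f\<^sub>k\<rangle> e\<^sub>k)\<close>. The biframe series of \<open>f\<close> is \<open>\<langle>C\<^sub>F f, C\<^sub>G f\<rangle> = \<langle>Q f, f\<rangle>\<close> with
  \<open>Q = C\<^sub>G* C\<^sub>F\<close>, so the biframe inequalities say that \<open>Q\<close> is positive and bounded below. The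
  adjoints map \<open>e\<^sub>k\<close> to \<open>f\<^sub>k\<close> and \<open>g\<^sub>k\<close>, and \<open>W = Q\<^sup>-\<^sup>r C\<^sub>F*\<close>, \<open>T = Q\<^sup>-\<^sup>t C\<^sub>G*\<close> satisfy
  \<open>T W* = Q\<^sup>-\<^sup>t Q Q\<^sup>-\<^sup>r = I\<close>.
  Conversely, for a factorization the series is \<open>\<langle>W* Q\<^sup>r f, T* Q\<^sup>t f\<rangle> = \<langle>Q f, f\<rangle>\<close>.

  The functional calculus rests on the bound of \<open>\<parallel>p(Q)\<parallel>\<close> by the supremum of \<open>|p|\<close> on the spectrum.
\<close>

section \<open>Complex inner product spaces\<close>

global_interpretation scaleC: vector_space "scaleC :: complex \<Rightarrow> 'a \<Rightarrow> 'a::complex_vector"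
  by (rule vector_space_scaleC)

lemma scaleR_scaleC: "s *\<^sub>R x = complex_of_real s *\<^sub>C (x :: 'a::complex_vector)"
  by (simp add: scaleC_of_real)

lemma cinner_add_right: "cinner x (y + z) = cinner x y + cinner x z"
  by (metis cinner_add_left cinner_commute complex_cnj_add)

lemma cinner_scaleC_right: "cinner x (a *\<^sub>C y) = cnj a * cinner x y"
  by (metis cinner_commute cinner_scaleC_left complex_cnj_mult)

lemma cinner_zero_left [simp]: "cinner 0 y = 0"
  using cinner_add_left[of 0 0 y] by simp

lemma cinner_zero_right [simp]: "cinner y 0 = 0"
  using cinner_add_right[of y 0 0] by simp

lemma cinner_diff_left: "cinner (x - y) z = cinner x z - cinner y z"
  using cinner_add_left[of "x - y" y z] by simp

lemma cinner_diff_right: "cinner x (y - z) = cinner x y - cinner x z"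
  using cinner_add_right[of x "y - z" z] by simp

lemma cinner_minus_left: "cinner (- x) z = - cinner x z"
  using cinner_diff_left[of 0 x z] by simp

lemma cinner_sum_left: "cinner (\<Sum>i\<in>A. f i) y = (\<Sum>i\<in>A. cinner (f i) y)"
  by (induction A rule: infinite_finite_induct) (auto simp: cinner_add_left)

lemma cinner_sum_right: "cinner y (\<Sum>i\<in>A. f i) = (\<Sum>i\<in>A. cinner y (f i))"
  by (induction A rule: infinite_finite_induct) (auto simp: cinner_add_right)

lemma cinner_scaleR_left: "cinner (s *\<^sub>R x) y = complex_of_real s * cinner x y"
  by (simp add: scaleR_scaleC cinner_scaleC_left)

lemma cinner_scaleR_right: "cinner x (s *\<^sub>R y) = complex_of_real s * cinner x y"
  by (simp add: scaleR_scaleC cinner_scaleC_right)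

lemmas cinner_simps = cinner_add_left cinner_add_right cinner_diff_left cinner_diff_right
  cinner_scaleC_left cinner_scaleC_right cinner_scaleR_left cinner_scaleR_right cinner_minus_left

lemma Re_cinner_self [simp]: "Re (cinner x x) = (norm x)\<^sup>2"
  by (simp add: cinner_self)

lemma Re_cinner_commute: "Re (cinner x y) = Re (cinner y x)"
  by (metis cinner_commute cnj.simps(1))

lemma cinner_eqI:
  assumes "\<And>z. cinner x z = cinner y z" shows "x = y"
proof -
  have "cinner (x - y) (x - y) = 0"
    using assms by (simp add: cinner_diff_left)
  thus ?thesis
    by (simp add: cinner_self)
qed

lemma complex_mult_cnj_cmod: "z * cnj z = complex_of_real ((cmod z)\<^sup>2)"
  by (rule complex_norm_square[symmetric])

lemma norm_scaleC [simp]: "norm (a *\<^sub>C (x :: 'a::complex_inner)) = cmod a * norm x"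
proof -
  have "complex_of_real ((norm (a *\<^sub>C x))\<^sup>2) = (a * cnj a) * cinner x x"
    by (simp only: cinner_self[symmetric] cinner_scaleC_left cinner_scaleC_right mult_ac)
  also have "\<dots> = complex_of_real ((cmod a * norm x)\<^sup>2)"
    by (simp add: cinner_self complex_mult_cnj_cmod power_mult_distrib)
  finally have "(norm (a *\<^sub>C x))\<^sup>2 = (cmod a * norm x)\<^sup>2"
    by (simp only: of_real_eq_iff)
  thus ?thesis
    by simp
qed

lemma norm_diff_sq:
  "(norm (x - y))\<^sup>2 = (norm x)\<^sup>2 - 2 * Re (cinner x y) + (norm (y :: 'a::complex_inner))\<^sup>2"
proof -
  have "(norm (x - y))\<^sup>2 = Re (cinner (x - y) (x - y))"
    by simp
  also have "\<dots> = (norm x)\<^sup>2 - 2 * Re (cinner x y) + (norm y)\<^sup>2"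
    using Re_cinner_commute[of y x] by (simp add: cinner_diff_left cinner_diff_right)
  finally show ?thesis .
qed

lemma cinner_Cauchy_Schwarz: "cmod (cinner x y) \<le> norm x * norm (y :: 'a::complex_inner)"
proof (cases "y = 0")
  case False
  \<comment> \<open>\<open>a *\<^sub>C y\<close> is the orthogonal projection of \<open>x\<close>
    onto the line through \<open>y\<close>; the squared length of the remainder is
    nonnegative.\<close>
  define a where "a = cinner x y / complex_of_real ((norm y)\<^sup>2)"
  have y: "norm y > 0" using False by simp
  have "0 \<le> (norm (x - a *\<^sub>C y))\<^sup>2"
    by simp
  also have "\<dots> = (norm x)\<^sup>2 - 2 * Re (cnj a * cinner x y) + (cmod a)\<^sup>2 * (norm y)\<^sup>2"
    by (simp only: norm_diff_sq cinner_scaleC_right norm_scaleC power_mult_distrib)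
  also have "cnj a * cinner x y = complex_of_real ((cmod (cinner x y))\<^sup>2 / (norm y)\<^sup>2)"
    unfolding a_def using complex_norm_square[of "cinner x y"] by (simp add: mult.commute)
  also have "(cmod a)\<^sup>2 * (norm y)\<^sup>2 = (cmod (cinner x y))\<^sup>2 / (norm y)\<^sup>2"
    using y by (simp add: a_def norm_divide norm_power power_divide field_simps power2_eq_square norm_mult)
  finally have "(cmod (cinner x y))\<^sup>2 / (norm y)\<^sup>2 \<le> (norm x)\<^sup>2"
    by simp
  hence "(cmod (cinner x y))\<^sup>2 \<le> (norm x * norm y)\<^sup>2"
    using y by (simp add: power_mult_distrib field_simps)
  thus ?thesis
    by (rule power2_le_imp_le) simp
qed simp

lemma bounded_bilinear_cinner: "bounded_bilinear (cinner :: 'a::complex_inner \<Rightarrow> 'a \<Rightarrow> complex)"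
proof
  show "\<exists>K. \<forall>x y :: 'a. cmod (cinner x y) \<le> norm x * norm y * K"
    by (rule exI[of _ 1]) (simp add: cinner_Cauchy_Schwarz)
qed (simp_all add: cinner_simps scaleR_conv_of_real)

lemmas tendsto_cinner = bounded_bilinear.tendsto[OF bounded_bilinear_cinner]

lemma bounded_linear_scaleC:
  "bounded_linear ((*\<^sub>C) a :: 'a::complex_inner \<Rightarrow> 'a)"
proof
  show "\<exists>K. \<forall>x :: 'a. norm (a *\<^sub>C x) \<le> norm x * K"
    by (rule exI[of _ "cmod a"]) (simp add: mult.commute)
qed (simp_all add: scaleC_add_right scaleR_scaleC scaleC_scaleC mult.commute)

lemmas tendsto_scaleC = bounded_linear.tendsto[OF bounded_linear_scaleC]

section \<open>Bounded complex-linear operators, adjoints and quadratic forms\<close>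

lemma bounded_clinearD:
  assumes "bounded_clinear T"
  shows "bounded_linear T" "T (x + y) = T x + T y" "T (x - y) = T x - T y" "T 0 = 0"
    "T (- x) = - T x" "T (c *\<^sub>C x) = c *\<^sub>C T x" "T (s *\<^sub>R x) = s *\<^sub>R T x"
    "T (\<Sum>i\<in>A. f i) = (\<Sum>i\<in>A. T (f i))"
  using assms unfolding bounded_clinear_def
  by (auto dest: bounded_linear.linear simp: linear_add linear_diff linear_0 linear_neg linear_sum
      linear_scale)

lemma bounded_clinear_pos_bound:
  assumes "bounded_clinear T"
  obtains K where "K > 0" "\<And>x. norm (T x) \<le> K * norm x"
  using bounded_linear.pos_bounded[OF bounded_clinearD(1)[OF assms]] by (metis mult.commute)

lemma bounded_clinearI:
  assumes "\<And>x y. T (x + y) = T x + T y" "\<And>c x. T (c *\<^sub>C x) = c *\<^sub>C T x"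
    "\<And>x. norm (T x) \<le> K * norm x"
  shows "bounded_clinear T"
  unfolding bounded_clinear_def
  by (intro conjI bounded_linear_intro[of _ K])
     (use assms in \<open>auto simp: scaleR_scaleC mult.commute\<close>)

lemma bounded_clinear_id: "bounded_clinear (\<lambda>x. x)"
  by (rule bounded_clinearI[of _ 1]) auto

lemma bounded_clinear_compose:
  assumes "bounded_clinear S" "bounded_clinear T"
  shows "bounded_clinear (\<lambda>x. S (T x))"
  using assms unfolding bounded_clinear_def by (auto intro: bounded_linear_compose)

lemma bounded_clinear_comp:
  assumes "bounded_clinear S" "bounded_clinear T"
  shows "bounded_clinear (S \<circ> T)"
  using bounded_clinear_compose[OF assms] by (simp add: o_def)

lemma bounded_clinear_diff:
  assumes "bounded_clinear S" "bounded_clinear T"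
  shows "bounded_clinear (\<lambda>x. S x - T x)"
  using assms unfolding bounded_clinear_def
  by (auto intro: bounded_linear_sub simp: scaleC.scale_right_diff_distrib)

lemma bounded_clinear_scaleC:
  assumes "bounded_clinear T"
  shows "bounded_clinear (\<lambda>x. a *\<^sub>C T x)"
  using assms unfolding bounded_clinear_def
  by (auto intro: bounded_linear_compose[OF bounded_linear_scaleC]
      simp: scaleC_scaleC mult.commute)

lemma bounded_clinear_sum:
  assumes "\<And>i. i \<in> A \<Longrightarrow> bounded_clinear (T i)"
  shows "bounded_clinear (\<lambda>x. \<Sum>i\<in>A. T i x)"
  using assms unfolding bounded_clinear_def
  by (auto intro: bounded_linear_sum simp: scaleC.scale_sum_right)

text \<open>\<open>cadjoint\<close> is a definite description. Since the inner product separates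
  points, any operator that satisfies the adjoint identity is the one described.\<close>

lemma cadjoint_eqI:
  assumes "\<And>x y. cinner (T x) y = cinner x (V y)"
  shows "cadjoint T = V"
  unfolding cadjoint_def
proof (rule the_equality)
  fix V' assume V': "\<forall>x y. cinner (T x) y = cinner x (V' y)"
  show "V' = V"
  proof
    fix y
    have "cinner (V' y) z = cinner (V y) z" for z
      by (metis V' assms cinner_commute)
    thus "V' y = V y" by (rule cinner_eqI)
  qed
qed (use assms in blast)

text \<open>Polarization: this is where complex scalars matter.\<close>

lemma symmetric_if_cinner_real:
  assumes T: "bounded_clinear T" and real: "\<And>x. cinner (T x) x \<in> \<real>"
  shows "cinner (T x) y = cinner x (T y)"
proof -
  have eq: "cinner (T x) y + cinner (T y) x = cinner x (T y) + cinner y (T x)" for x y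
  proof -
    have "cinner (T (x + y)) (x + y) = cinner (x + y) (T (x + y))"
      by (metis real Reals_cnj_iff cinner_commute)
    moreover have "cinner (T x) x = cinner x (T x)" "cinner (T y) y = cinner y (T y)"
      by (metis real Reals_cnj_iff cinner_commute)+
    ultimately show ?thesis
      by (simp add: bounded_clinearD[OF T] cinner_simps add.commute)
  qed
  \<comment> \<open>Replacing \<open>y\<close> by \<open>\<i> *\<^sub>C y\<close> changes the
    relative sign of the two cross terms, so that together with \<open>eq\<close> at
    \<open>y\<close> itself each of them is determined.\<close>
  have "cinner (T x) y * (- \<i>) + \<i> * cinner (T y) x = - \<i> * cinner x (T y) + \<i> * cinner y (T x)"
    using eq[of x "\<i> *\<^sub>C y"] by (simp add: bounded_clinearD[OF T] cinner_simps mult.commute)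
  hence "\<i> * (cinner (T y) x - cinner (T x) y) = \<i> * (cinner y (T x) - cinner x (T y))"
    by algebra
  hence "cinner (T y) x - cinner (T x) y = cinner y (T x) - cinner x (T y)"
    by simp
  hence "2 * cinner (T x) y = 2 * cinner x (T y)"
    using eq[of x y] by algebra
  thus ?thesis by simp
qed

text \<open>Expanding \<open>\<langle>T z, z\<rangle> \<ge> 0\<close> at \<open>z = x - T x / K\<close> gives \<open>\<parallel>T x\<parallel>\<^sup>2 \<le> K \<langle>T x, x\<rangle>\<close>.\<close>

lemma coercive_if_bounded_below:
  assumes T: "bounded_clinear T"
    and pos: "\<And>x. cinner (T x) x \<in> \<real>\<^sub>\<ge>\<^sub>0"
    and \<alpha>: "\<alpha> > 0" "\<And>x. \<alpha> * norm x \<le> norm (T x)"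
  obtains c where "c > 0" "\<And>x. c * (norm x)\<^sup>2 \<le> Re (cinner (T x) x)"
proof -
  obtain K where K: "K > 0" "\<And>x. norm (T x) \<le> K * norm x"
    using bounded_clinear_pos_bound[OF T] by blast
  have sym: "cinner (T x) y = cinner x (T y)" for x y
    by (rule symmetric_if_cinner_real[OF T]) (use pos nonneg_Reals_subset_Reals in blast)
  have "\<alpha>\<^sup>2 / K * (norm x)\<^sup>2 \<le> Re (cinner (T x) x)" for x
  proof -
    let ?s = "1 / K"
    have nonneg: "0 \<le> Re (cinner (T (x - ?s *\<^sub>R T x)) (x - ?s *\<^sub>R T x))"
      using pos complex_nonneg_Reals_iff by blast
    have eq: "Re (cinner (T (x - ?s *\<^sub>R T x)) (x - ?s *\<^sub>R T x))
        = Re (cinner (T x) x) - 2 * ?s * (norm (T x))\<^sup>2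
        + ?s\<^sup>2 * Re (cinner (T (T x)) (T x))"
      by (simp add: bounded_clinearD[OF T] cinner_simps sym[of "T x" x] power2_eq_square
          diff_divide_distrib del: of_real_divide)
    have "Re (cinner (T (T x)) (T x)) \<le> K * (norm (T x))\<^sup>2"
    proof -
      have "Re (cinner (T (T x)) (T x)) \<le> norm (T (T x)) * norm (T x)"
        using cinner_Cauchy_Schwarz complex_Re_le_cmod order_trans by blast
      also have "\<dots> \<le> (K * norm (T x)) * norm (T x)"
        by (intro mult_right_mono K) simp
      finally show ?thesis by (simp add: power2_eq_square mult.assoc)
    qed
    hence "?s\<^sup>2 * Re (cinner (T (T x)) (T x)) \<le> ?s\<^sup>2 * (K * (norm (T x))\<^sup>2)"
      by (rule mult_left_mono) simp
    \<comment> \<open>With \<open>?s = 1 / K\<close> this cancels only one of the two copies of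
      \<open>?s * (norm (T x))\<^sup>2\<close> subtracted in \<open>eq\<close>; the other copy is
      the lower bound.\<close>
    also have "\<dots> = ?s * (norm (T x))\<^sup>2"
      using K by (simp add: power2_eq_square)
    finally have "(norm (T x))\<^sup>2 / K \<le> Re (cinner (T x) x)"
      using nonneg eq by simp
    moreover have "(\<alpha> * norm x)\<^sup>2 \<le> (norm (T x))\<^sup>2"
      using \<alpha> by (intro power_mono) auto
    hence "\<alpha>\<^sup>2 / K * (norm x)\<^sup>2 \<le> (norm (T x))\<^sup>2 / K"
      using K by (simp add: power_mult_distrib field_simps)
    ultimately show ?thesis by linarith
  qed
  thus ?thesis using that[of "\<alpha>\<^sup>2 / K"] \<alpha> K by simp
qed

section \<open>Orthonormal bases and analysis operators\<close>

lemma norm_sum_orthonormal: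
  fixes e :: "nat \<Rightarrow> 'a::chilbert_space"
  assumes "orthonormal_basis e" "finite A"
  shows "(norm (\<Sum>k\<in>A. a k *\<^sub>C e k))\<^sup>2 = (\<Sum>k\<in>A. (cmod (a k))\<^sup>2)"
proof -
  have on: "cinner (e j) (e k) = (if j = k then 1 else 0)" for j k
    using assms(1) by (simp add: orthonormal_basis_def)
  have "cinner (\<Sum>k\<in>A. a k *\<^sub>C e k) (\<Sum>k\<in>A. a k *\<^sub>C e k) = (\<Sum>k\<in>A. a k * cnj (a k))"
    using assms(2)
    by (simp add: cinner_sum_left cinner_sum_right cinner_simps on if_distrib mult.commute cong: if_cong)
  also have "\<dots> = complex_of_real (\<Sum>k\<in>A. (cmod (a k))\<^sup>2)"
    by (simp add: complex_mult_cnj_cmod)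
  finally show ?thesis
    by (simp add: cinner_self del: of_real_power of_real_sum)
qed

text \<open>By Pythagoras the blocks of the vector series have the same squared size as those of the
  scalar series, so the Cauchy criterion carries over and completeness gives the limit.\<close>

lemma summable_orthonormal:
  fixes e :: "nat \<Rightarrow> 'a::chilbert_space"
  assumes e: "orthonormal_basis e" and a: "summable (\<lambda>k. (cmod (a k))\<^sup>2)"
  shows "summable (\<lambda>k. a k *\<^sub>C e k)"
  unfolding summable_Cauchy
proof (intro allI impI)
  fix \<epsilon> :: real assume "\<epsilon> > 0"
  then obtain N where N: "\<And>m n. m \<ge> N \<Longrightarrow> norm (\<Sum>k=m..<n. (cmod (a k))\<^sup>2) < \<epsilon>\<^sup>2"
    using a unfolding summable_Cauchy by (meson zero_less_power)
  have "norm (\<Sum>k=m..<n. a k *\<^sub>C e k) < \<epsilon>" if "m \<ge> N" for m n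
  proof (rule power2_less_imp_less)
    show "(norm (\<Sum>k=m..<n. a k *\<^sub>C e k))\<^sup>2 < \<epsilon>\<^sup>2"
      using N[OF that, of n] by (simp add: norm_sum_orthonormal[OF e] sum_nonneg)
  qed (use \<open>\<epsilon> > 0\<close> in simp)
  thus "\<exists>N. \<forall>m\<ge>N. \<forall>n. norm (\<Sum>k=m..<n. a k *\<^sub>C e k) < \<epsilon>" by blast
qed

lemma bessel_sequenceI:
  assumes "\<And>f n. (\<Sum>k<n. (cmod (cinner f (F k)))\<^sup>2) \<le> B * (norm f)\<^sup>2" "B > 0"
  shows "bessel_sequence F"
  unfolding bessel_sequence_def
proof (intro exI[of _ B] conjI allI)
  fix f
  show s: "summable (\<lambda>k. (cmod (cinner f (F k)))\<^sup>2)"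
    by (rule summableI_nonneg_bounded[OF _ assms(1)]) simp
  show "(\<Sum>k. (cmod (cinner f (F k)))\<^sup>2) \<le> B * (norm f)\<^sup>2"
    by (rule suminf_le_const[OF s assms(1)])
qed fact

text \<open>Obtained by duality with finite combinations of basis vectors instead of the adjoint of
  \<open>W\<close>, because the adjoint is itself constructed from this bound.\<close>

lemma bessel_sequence_image:
  fixes e :: "nat \<Rightarrow> 'a::chilbert_space" and W :: "'a \<Rightarrow> 'b::chilbert_space"
  assumes e: "orthonormal_basis e" and W: "bounded_clinear W"
  shows "bessel_sequence (\<lambda>k. W (e k))"
proof -
  obtain K where K: "K > 0" "\<And>x. norm (W x) \<le> K * norm x"
    using bounded_clinear_pos_bound[OF W] by blast
  show ?thesis
  proof (rule bessel_sequenceI)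
    fix y n
    define a where "a = (\<lambda>k. cinner y (W (e k)))"
    define s where "s = (\<Sum>k<n. (cmod (a k))\<^sup>2)"
    \<comment> \<open>These coefficients make \<open>cinner y (W v)\<close> equal to
      \<open>(norm v)\<^sup>2\<close>, so one factor \<open>norm v\<close> cancels from the
      Cauchy-Schwarz bound.\<close>
    define v where "v = (\<Sum>k<n. a k *\<^sub>C e k)"
    have s0: "s \<ge> 0" by (simp add: s_def sum_nonneg)
    have v: "(norm v)\<^sup>2 = s"
      by (simp add: v_def s_def norm_sum_orthonormal[OF e])
    have "cinner y (W v) = (\<Sum>k<n. a k * cnj (a k))"
      by (simp add: v_def bounded_clinearD[OF W] cinner_sum_right cinner_simps a_def mult.commute)
    also have "\<dots> = complex_of_real s"
      by (simp add: s_def complex_mult_cnj_cmod)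
    finally have "s = cmod (cinner y (W v))"
      using s0 by simp
    also have "\<dots> \<le> norm y * (K * norm v)"
      by (meson K(2) cinner_Cauchy_Schwarz mult_left_mono norm_ge_zero order_trans)
    finally have "(norm v)\<^sup>2 \<le> norm y * (K * norm v)"
      by (simp add: v)
    hence "norm v \<le> K * norm y"
      using K by (cases "norm v = 0") (auto simp: power2_eq_square mult.commute)
    hence "(norm v)\<^sup>2 \<le> (K * norm y)\<^sup>2"
      by (rule power_mono) simp
    thus "(\<Sum>k<n. (cmod (cinner y (W (e k))))\<^sup>2) \<le> K\<^sup>2 * (norm y)\<^sup>2"
      by (simp add: v s_def a_def power_mult_distrib)
  qed (use K in simp)
qed

lemma orthonormal_basis_bessel:
  assumes "orthonormal_basis e" shows "bessel_sequence e"
  using bessel_sequence_image[OF assms bounded_clinear_id] by simp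

text \<open>The usual analysis operator has values in the square-summable sequences. Here the basis
  \<open>e\<close> carries these into \<open>'a\<close>, so that \<open>cadjoint\<close> applies.
  The series is meaningful when \<open>F\<close> is a Bessel sequence.\<close>

definition analysis_op ::
    "(nat \<Rightarrow> 'a::chilbert_space) \<Rightarrow> (nat \<Rightarrow> 'b::chilbert_space) \<Rightarrow> 'b \<Rightarrow> 'a" where
  "analysis_op e F f = (\<Sum>k. cinner f (F k) *\<^sub>C e k)"

lemma analysis_op_sums:
  assumes "orthonormal_basis e" "bessel_sequence F"
  shows "(\<lambda>k. cinner f (F k) *\<^sub>C e k) sums analysis_op e F f"
  unfolding analysis_op_def
  using assms by (intro summable_sums summable_orthonormal) (auto simp: bessel_sequence_def)

lemma bounded_clinear_analysis_op:
  assumes e: "orthonormal_basis e" and F: "bessel_sequence F"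
  shows "bounded_clinear (analysis_op e F)"
proof -
  note sums = analysis_op_sums[OF e F]
  obtain B where B: "B > 0" "\<And>f. summable (\<lambda>k. (cmod (cinner f (F k)))\<^sup>2)"
      "\<And>f. (\<Sum>k. (cmod (cinner f (F k)))\<^sup>2) \<le> B * (norm f)\<^sup>2"
    using F by (auto simp: bessel_sequence_def)
  show ?thesis
  proof (rule bounded_clinearI)
    fix f g c
    show "analysis_op e F (f + g) = analysis_op e F f + analysis_op e F g"
      using sums_add[OF sums[of f] sums[of g]]
      by (intro sums_unique2[OF sums]) (simp add: cinner_simps scaleC_add_left)
    show "analysis_op e F (c *\<^sub>C f) = c *\<^sub>C analysis_op e F f"
      using bounded_linear.sums[OF bounded_linear_scaleC sums[of f], of c]
      by (intro sums_unique2[OF sums]) (simp add: cinner_simps scaleC_scaleC)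
    have le: "norm (\<Sum>k<n. cinner f (F k) *\<^sub>C e k) \<le> sqrt (B * (norm f)\<^sup>2)" for n
    proof -
      have "(norm (\<Sum>k<n. cinner f (F k) *\<^sub>C e k))\<^sup>2 = (\<Sum>k<n. (cmod (cinner f (F k)))\<^sup>2)"
        by (simp add: norm_sum_orthonormal[OF e])
      also have "\<dots> \<le> B * (norm f)\<^sup>2"
        using sum_le_suminf[OF B(2)[of f], of "{..<n}"] B(3)[of f] by simp
      finally show ?thesis by (rule real_le_rsqrt)
    qed
    have "(\<lambda>n. norm (\<Sum>k<n. cinner f (F k) *\<^sub>C e k)) \<longlonglongrightarrow> norm (analysis_op e F f)"
      using sums[of f] unfolding sums_def by (rule tendsto_norm)
    hence "norm (analysis_op e F f) \<le> sqrt (B * (norm f)\<^sup>2)"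
      by (rule Lim_bounded) (use le in blast)
    thus "norm (analysis_op e F f) \<le> sqrt B * norm f"
      by (simp add: real_sqrt_mult)
  qed
qed

lemma cinner_analysis_op_sums:
  assumes "orthonormal_basis e" "bessel_sequence F"
  shows "(\<lambda>k. cinner f (F k) * cinner (e k) x) sums cinner (analysis_op e F f) x"
  using bounded_linear.sums[OF bounded_bilinear.bounded_linear_left[OF bounded_bilinear_cinner]
      analysis_op_sums[OF assms]]
  by (simp add: cinner_simps)

lemma cinner_analysis_op_basis:
  assumes "orthonormal_basis e" "bessel_sequence F"
  shows "cinner (analysis_op e F f) (e k) = cinner f (F k)"
proof (rule sums_unique2[OF cinner_analysis_op_sums[OF assms]])
  have "(\<lambda>j. cinner f (F j) * cinner (e j) (e k)) = (\<lambda>j. if j = k then cinner f (F j) else 0)"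
    using assms(1) by (auto simp: orthonormal_basis_def fun_eq_iff)
  thus "(\<lambda>j. cinner f (F j) * cinner (e j) (e k)) sums cinner f (F k)"
    using sums_single[of k "\<lambda>j. cinner f (F j)"] by simp
qed

text \<open>The error \<open>d\<close> is orthogonal to every basis vector. The vectors orthogonal
  to \<open>d\<close> form a closed subspace, which by density of the span is everything and so
  contains \<open>d\<close>.\<close>

lemma analysis_op_self:
  assumes e: "orthonormal_basis e"
  shows "analysis_op e e x = x"
proof -
  note b = orthonormal_basis_bessel[OF e]
  define d where "d = analysis_op e e x - x"
  let ?Z = "{y. cinner d y = 0}"
  have "scaleC.subspace ?Z"
    by (rule scaleC.subspaceI) (auto simp: cinner_simps)
  moreover have "range e \<subseteq> ?Z"
    using cinner_analysis_op_basis[OF e b] by (auto simp: d_def cinner_diff_left)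
  ultimately have "module.span scaleC (range e) \<subseteq> ?Z"
    by (intro scaleC.span_minimal)
  moreover have "closed ?Z"
    by (intro closed_Collect_eq continuous_on_const linear_continuous_on
        bounded_bilinear.bounded_linear_right[OF bounded_bilinear_cinner])
  ultimately have "closure (module.span scaleC (range e)) \<subseteq> ?Z"
    by (rule closure_minimal)
  hence "cinner d d = 0"
    using e by (auto simp: orthonormal_basis_def)
  thus ?thesis by (simp add: cinner_self d_def)
qed

lemma Parseval:
  assumes "orthonormal_basis e"
  shows "(\<lambda>k. cinner x (e k) * cinner (e k) y) sums cinner x y"
  using cinner_analysis_op_sums[OF assms orthonormal_basis_bessel[OF assms]]
  by (simp add: analysis_op_self[OF assms])

text \<open>Both sides are sums of one series: the left by expanding \<open>x\<close> in the basis
  and using continuity of \<open>W\<close>, the right by Parseval.\<close>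

lemma cinner_analysis_op:
  fixes e :: "nat \<Rightarrow> 'a::chilbert_space" and W :: "'a \<Rightarrow> 'b::chilbert_space"
  assumes e: "orthonormal_basis e" and W: "bounded_clinear W"
  shows "cinner (W x) y = cinner x (analysis_op e (\<lambda>k. W (e k)) y)"
proof (rule sums_unique2)
  show "(\<lambda>k. cinner x (e k) * cinner (W (e k)) y) sums cinner (W x) y"
  proof -
    have b: "bounded_linear (\<lambda>x. cinner (W x) y)"
      by (rule bounded_linear_compose[OF
          bounded_bilinear.bounded_linear_left[OF bounded_bilinear_cinner] bounded_clinearD(1)[OF W]])
    show ?thesis
      using bounded_linear.sums[OF b
          analysis_op_sums[OF e orthonormal_basis_bessel[OF e]], of x]
      by (simp add: analysis_op_self[OF e] bounded_clinearD[OF W] cinner_simps)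
  qed
  let ?V = "analysis_op e (\<lambda>k. W (e k))"
  have "cinner (e k) (?V y) = cinner (W (e k)) y" for k
    by (metis cinner_analysis_op_basis[OF e bessel_sequence_image[OF e W]] cinner_commute)
  thus "(\<lambda>k. cinner x (e k) * cinner (W (e k)) y) sums cinner x (?V y)"
    using Parseval[OF e, of x "?V y"] by simp
qed

text \<open>
  The basis provides the adjoint explicitly, which makes the Riesz representation theorem
  unnecessary.
\<close>

lemma cadjoint_eq_analysis_op:
  fixes e :: "nat \<Rightarrow> 'a::chilbert_space" and W :: "'a \<Rightarrow> 'b::chilbert_space"
  assumes "orthonormal_basis e" "bounded_clinear W"
  shows "cadjoint W = analysis_op e (\<lambda>k. W (e k))"
  by (rule cadjoint_eqI) (rule cinner_analysis_op[OF assms])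

lemma cinner_cadjoint:
  fixes e :: "nat \<Rightarrow> 'a::chilbert_space" and W :: "'a \<Rightarrow> 'b::chilbert_space"
  assumes "orthonormal_basis e" "bounded_clinear W"
  shows "cinner (W x) y = cinner x (cadjoint W y)"
  by (simp add: cadjoint_eq_analysis_op[OF assms] cinner_analysis_op[OF assms])

lemma bounded_clinear_cadjoint:
  fixes e :: "nat \<Rightarrow> 'a::chilbert_space" and W :: "'a \<Rightarrow> 'b::chilbert_space"
  assumes "orthonormal_basis e" "bounded_clinear W"
  shows "bounded_clinear (cadjoint W)"
  unfolding cadjoint_eq_analysis_op[OF assms]
  by (intro bounded_clinear_analysis_op bessel_sequence_image assms)

text \<open>The adjoint is the synthesis operator. This is how a sequence is recovered from its
  operator when \<open>W\<close> and \<open>T\<close> are built.\<close>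

lemma cadjoint_analysis_op_basis:
  fixes e :: "nat \<Rightarrow> 'a::chilbert_space" and F :: "nat \<Rightarrow> 'a"
  assumes e: "orthonormal_basis e" and F: "bessel_sequence F"
  shows "cadjoint (analysis_op e F) (e k) = F k"
proof (rule cinner_eqI)
  fix f
  show "cinner (cadjoint (analysis_op e F) (e k)) f = cinner (F k) f"
    by (metis cinner_analysis_op_basis[OF e F] cinner_cadjoint[OF e bounded_clinear_analysis_op[OF e F]]
        cinner_commute)
qed

section \<open>Invertible operators and the spectrum\<close>

text \<open>The condition negated in \<open>op_spectrum\<close>, freed from the shift by
  \<open>z\<close>.\<close>

definition op_invertible :: "('a::chilbert_space \<Rightarrow> 'a) \<Rightarrow> bool" where
  "op_invertible A \<longleftrightarrow> (\<exists>R. bounded_clinear R \<and> R \<circ> A = id \<and> A \<circ> R = id)"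

lemma op_spectrum_iff: "z \<in> op_spectrum Q \<longleftrightarrow> \<not> op_invertible (\<lambda>x. Q x - z *\<^sub>C x)"
  by (simp add: op_spectrum_def op_invertible_def)

lemma op_invertibleI:
  assumes "bounded_clinear R" "\<And>x. R (A x) = x" "\<And>x. A (R x) = x"
  shows "op_invertible A"
  unfolding op_invertible_def by (rule exI[of _ R]) (simp add: assms fun_eq_iff)

lemma op_invertibleE:
  assumes "op_invertible A"
  obtains R where "bounded_clinear R" "\<And>x. R (A x) = x" "\<And>x. A (R x) = x"
  using assms unfolding op_invertible_def by (metis comp_apply id_apply)

lemma op_invertible_scaleC_id:
  assumes "a \<noteq> 0" shows "op_invertible (\<lambda>x :: 'a::chilbert_space. a *\<^sub>C x)"
  by (rule op_invertibleI[of "\<lambda>x. inverse a *\<^sub>C x"])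
     (use assms in \<open>simp_all add: scaleC_scaleC bounded_clinear_scaleC bounded_clinear_id\<close>)

lemma op_invertible_compose:
  assumes "op_invertible A" "op_invertible B"
  shows "op_invertible (\<lambda>x. A (B x))"
proof -
  obtain R where R: "bounded_clinear R" "\<And>x. R (A x) = x" "\<And>x. A (R x) = x"
    using op_invertibleE[OF assms(1)] by blast
  obtain S where S: "bounded_clinear S" "\<And>x. S (B x) = x" "\<And>x. B (S x) = x"
    using op_invertibleE[OF assms(2)] by blast
  show ?thesis
    by (rule op_invertibleI[of "\<lambda>x. S (R x)"]) (simp_all add: R S bounded_clinear_compose)
qed

text \<open>Coercivity looks at the real part of the form, so an operator may have to be rotated or
  negated before it becomes coercive; this undoes the change.\<close>

lemma op_invertible_scaleC_cancel:
  assumes "op_invertible (\<lambda>x. u *\<^sub>C A x)" "u \<noteq> 0"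
  shows "op_invertible A"
proof -
  have "op_invertible (\<lambda>x. inverse u *\<^sub>C (u *\<^sub>C A x))"
    by (rule op_invertible_compose[OF op_invertible_scaleC_id assms(1)]) (use assms(2) in simp)
  thus ?thesis using assms(2) by (simp add: scaleC_scaleC)
qed

lemma op_invertible_bounded_below:
  assumes "op_invertible A"
  obtains \<alpha> where "\<alpha> > 0" "\<And>x. \<alpha> * norm x \<le> norm (A x)"
proof -
  obtain R where R: "bounded_clinear R" "\<And>x. R (A x) = x" "\<And>x. A (R x) = x"
    using op_invertibleE[OF assms] by blast
  obtain K where K: "K > 0" "\<And>x. norm (R x) \<le> K * norm x"
    using bounded_clinear_pos_bound[OF R(1)] by blast
  have "1 / K * norm x \<le> norm (A x)" for x
    using K(2)[of "A x"] K(1) by (simp add: R(2) field_simps)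
  thus ?thesis using that[of "1 / K"] K(1) by simp
qed

text \<open>
  The Lax--Milgram theorem: for suitable \<open>\<tau> > 0\<close> the map \<open>x \<mapsto> x - \<tau> (A x - y)\<close> is a contraction,
  and its fixed point solves \<open>A x = y\<close>.
\<close>

lemma op_invertible_if_coercive:
  fixes A :: "'a::chilbert_space \<Rightarrow> 'a"
  assumes A: "bounded_clinear A" and c: "c > 0" "\<And>x. c * (norm x)\<^sup>2 \<le> Re (cinner (A x) x)"
  shows "op_invertible A"
proof -
  obtain K0 where K0: "K0 > 0" "\<And>x. norm (A x) \<le> K0 * norm x"
    using bounded_clinear_pos_bound[OF A] by blast
  \<comment> \<open>The maximum ensures \<open>c \<le> K\<close>, which keeps the radicand in
    \<open>\<rho>\<close> nonnegative.\<close>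
  define K where "K = max K0 c"
  have K: "K > 0" "c \<le> K" "\<And>x. norm (A x) \<le> K * norm x"
  proof -
    fix x :: 'a
    have "K0 * norm x \<le> K * norm x" by (intro mult_right_mono) (auto simp: K_def)
    thus "norm (A x) \<le> K * norm x" using K0(2)[of x] by linarith
  qed (use K0 in \<open>auto simp: K_def\<close>)
  \<comment> \<open>This \<open>\<tau>\<close> minimizes
    \<open>1 - 2 * \<tau> * c + \<tau>\<^sup>2 * K\<^sup>2\<close>, the bound for the squared
    contraction factor; \<open>\<rho>\<close> is the square root of the minimum.\<close>
  define \<tau> where "\<tau> = c / K\<^sup>2"
  define \<rho> where "\<rho> = sqrt (1 - c\<^sup>2 / K\<^sup>2)"
  have cK: "0 < c\<^sup>2 / K\<^sup>2" "c\<^sup>2 / K\<^sup>2 \<le> 1"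
    using K(1,2) c(1) by (auto simp: power_mono)
  have \<tau>: "\<tau> > 0" using c K by (simp add: \<tau>_def)
  have contr: "norm (x - \<tau> *\<^sub>R A x) \<le> \<rho> * norm x" for x
  proof (rule power2_le_imp_le)
    have "(norm (x - \<tau> *\<^sub>R A x))\<^sup>2
        = (norm x)\<^sup>2 - 2 * \<tau> * Re (cinner (A x) x) + \<tau>\<^sup>2 * (norm (A x))\<^sup>2"
      using Re_cinner_commute[of x "A x"]
      by (simp add: norm_diff_sq cinner_simps power_mult_distrib)
    moreover have "\<tau> * (c * (norm x)\<^sup>2) \<le> \<tau> * Re (cinner (A x) x)"
      using c(2)[of x] \<tau> by (intro mult_left_mono) auto
    moreover have "\<tau>\<^sup>2 * (norm (A x))\<^sup>2 \<le> \<tau>\<^sup>2 * (K * norm x)\<^sup>2"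
      using K(3)[of x] by (intro mult_left_mono power_mono) auto
    moreover have "\<tau>\<^sup>2 * (K * norm x)\<^sup>2 = c\<^sup>2 / K\<^sup>2 * (norm x)\<^sup>2"
      using K(1) by (simp add: \<tau>_def power_divide power_mult_distrib power2_eq_square)
    moreover have "\<tau> * (c * (norm x)\<^sup>2) = c\<^sup>2 / K\<^sup>2 * (norm x)\<^sup>2"
      by (simp add: \<tau>_def power2_eq_square)
    ultimately have "(norm (x - \<tau> *\<^sub>R A x))\<^sup>2 \<le> (1 - c\<^sup>2 / K\<^sup>2) * (norm x)\<^sup>2"
      by (simp add: left_diff_distrib)
    also have "\<dots> = (\<rho> * norm x)\<^sup>2"
      using cK by (simp add: \<rho>_def power_mult_distrib)
    finally show "(norm (x - \<tau> *\<^sub>R A x))\<^sup>2 \<le> (\<rho> * norm x)\<^sup>2" .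
  qed (use cK in \<open>simp add: \<rho>_def\<close>)
  have ex1: "\<exists>!x. A x = y" for y
  proof -
    have "\<exists>!x. x - \<tau> *\<^sub>R (A x - y) = x"
    proof (rule banach_fix_type[of \<rho>])
      show "0 \<le> \<rho>" "\<rho> < 1" using cK by (auto simp: \<rho>_def)
      show "\<forall>x z. dist (x - \<tau> *\<^sub>R (A x - y)) (z - \<tau> *\<^sub>R (A z - y)) \<le> \<rho> * dist x z"
      proof (intro allI)
        fix x z
        have "(x - \<tau> *\<^sub>R (A x - y)) - (z - \<tau> *\<^sub>R (A z - y)) = (x - z) - \<tau> *\<^sub>R A (x - z)"
          by (simp add: bounded_clinearD[OF A] algebra_simps)
        thus "dist (x - \<tau> *\<^sub>R (A x - y)) (z - \<tau> *\<^sub>R (A z - y)) \<le> \<rho> * dist x z"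
          unfolding dist_norm using contr[of "x - z"] by (simp only:)
      qed
    qed
    thus ?thesis using \<tau> by simp
  qed
  define R where "R = (\<lambda>y. THE x. A x = y)"
  have AR: "A (R y) = y" for y
    unfolding R_def using theI'[OF ex1[of y]] .
  have RA: "R (A x) = x" for x
    using ex1[of "A x"] AR[of "A x"] by blast
  have "bounded_clinear R"
  proof (rule bounded_clinearI)
    show "R (x + y) = R x + R y" for x y
      by (metis AR RA bounded_clinearD(2)[OF A])
    show "R (a *\<^sub>C x) = a *\<^sub>C R x" for a x
      by (metis AR RA bounded_clinearD(6)[OF A])
    show "norm (R y) \<le> 1 / c * norm y" for y
    proof (cases "R y = 0")
      case False
      have "c * (norm (R y))\<^sup>2 \<le> norm y * norm (R y)"
        using c(2)[of "R y"] complex_Re_le_cmod[of "cinner y (R y)"]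
          cinner_Cauchy_Schwarz[of y "R y"] by (simp add: AR)
      thus ?thesis using False c by (simp add: power2_eq_square field_simps)
    qed (use c in simp)
  qed
  thus ?thesis
    using RA AR by (rule op_invertibleI)
qed

section \<open>The polynomial calculus\<close>

text \<open>Padding with zero coefficients gives polynomials of different degrees a common summation
  range.\<close>

lemma poly_op_eq_sum:
  assumes "degree p \<le> n"
  shows "poly_op p Q x = (\<Sum>i\<le>n. coeff p i *\<^sub>C (Q ^^ i) x)"
  unfolding poly_op_def
  by (rule sum.mono_neutral_left) (use assms in \<open>auto simp: coeff_eq_0\<close>)

lemma poly_op_0 [simp]: "poly_op 0 Q x = 0"
  by (simp add: poly_op_def)

lemma poly_op_add: "poly_op (p + q) Q x = poly_op p Q x + poly_op q Q x"
proof -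
  define n where "n = max (degree p) (degree q)"
  have "degree p \<le> n" "degree q \<le> n" "degree (p + q) \<le> n"
    by (auto simp: n_def degree_add_le_max)
  thus ?thesis
    by (simp add: poly_op_eq_sum[of _ n] scaleC_add_left sum.distrib)
qed

lemma poly_op_smult: "poly_op (smult a p) Q x = a *\<^sub>C poly_op p Q x"
  by (simp add: poly_op_eq_sum[OF degree_smult_le] poly_op_def scaleC.scale_sum_right scaleC_scaleC)

lemma poly_op_diff: "poly_op (p - q) Q x = poly_op p Q x - poly_op q Q x"
proof -
  have "p - q = p + smult (- 1) q" by simp
  thus ?thesis
    unfolding poly_op_add poly_op_smult \<open>p - q = _\<close> by simp
qed

text \<open>Horner's recursion, which drives the inductions over polynomials.\<close>

lemma poly_op_pCons: "poly_op (pCons a p) Q x = a *\<^sub>C x + poly_op p Q (Q x)"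
proof -
  have "poly_op (pCons a p) Q x = (\<Sum>i\<le>Suc (degree p). coeff (pCons a p) i *\<^sub>C (Q ^^ i) x)"
    by (rule poly_op_eq_sum) (rule degree_pCons_le)
  also have "\<dots> = a *\<^sub>C x + (\<Sum>i\<le>degree p. coeff p i *\<^sub>C (Q ^^ i) (Q x))"
    unfolding sum.atMost_Suc_shift by (simp add: funpow_swap1)
  finally show ?thesis by (simp add: poly_op_def)
qed

lemma poly_op_commute:
  assumes "bounded_clinear Q"
  shows "poly_op p Q (Q x) = Q (poly_op p Q x)"
  by (simp add: poly_op_def bounded_clinearD[OF assms] funpow_swap1)

lemma poly_op_mult:
  assumes "bounded_clinear Q"
  shows "poly_op (p * q) Q x = poly_op p Q (poly_op q Q x)"
proof (induction p arbitrary: x)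
  case (pCons a p)
  thus ?case
    by (simp add: poly_op_add poly_op_smult poly_op_pCons poly_op_commute[OF assms])
qed simp

lemma bounded_clinear_poly_op:
  assumes "bounded_clinear Q" shows "bounded_clinear (poly_op p Q)"
proof -
  have "bounded_clinear (Q ^^ i)" for i
    by (induction i) (simp_all add: bounded_clinear_id id_def o_def bounded_clinear_compose[OF assms])
  thus ?thesis
    unfolding poly_op_def[abs_def]
    by (intro bounded_clinear_sum bounded_clinear_scaleC) auto
qed

text \<open>Spectral mapping: factor \<open>q\<close> into linear polynomials.\<close>

lemma op_invertible_poly_op:
  assumes Q: "bounded_clinear Q"
  shows "q \<noteq> 0 \<Longrightarrow> (\<And>z. poly q z = 0 \<Longrightarrow> z \<notin> op_spectrum Q) \<Longrightarrow> op_invertible (poly_op q Q)"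
proof (induction "degree q" arbitrary: q)
  case 0
  then obtain a where a: "q = [:a:]" "a \<noteq> 0"
    by (metis degree_eq_zeroE pCons_0_0)
  have "poly_op q Q = (\<lambda>x. a *\<^sub>C x)"
    by (simp add: a fun_eq_iff poly_op_pCons)
  thus ?case
    by (simp add: op_invertible_scaleC_id[OF a(2)])
next
  case (Suc n)
  have "\<not> constant (poly q)"
    using Suc.hyps(2) by (simp add: constant_degree)
  then obtain z where z: "poly q z = 0"
    using fundamental_theorem_of_algebra by blast
  then obtain q' where q': "q = [:- z, 1:] * q'"
    by (metis poly_eq_0_iff_dvd dvdE)
  have nz: "q' \<noteq> 0" using Suc.prems(1) q' by auto
  have "degree q = Suc (degree q')"
    unfolding q' using nz by (subst degree_mult_eq) auto
  \<comment> \<open>Every root of \<open>q'\<close> is a root of \<open>q\<close>, so the assumption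
    on the roots passes to the quotient.\<close>
  hence "op_invertible (poly_op q' Q)"
    using Suc nz q' by (intro Suc.hyps(1)) auto
  moreover have "op_invertible (\<lambda>x. Q x - z *\<^sub>C x)"
    using Suc.prems(2)[OF z] by (simp add: op_spectrum_iff)
  moreover have "poly_op q Q = (\<lambda>x. Q (poly_op q' Q x) - z *\<^sub>C poly_op q' Q x)"
    unfolding q' poly_op_mult[OF Q] fun_eq_iff by (simp add: poly_op_pCons)
  ultimately show ?case
    using op_invertible_compose[of "\<lambda>x. Q x - z *\<^sub>C x" "poly_op q' Q"] by simp
qed

section \<open>Continuous functional calculus of a self-adjoint operator\<close>

text \<open>The property inside the description operator of \<open>functional_calculus\<close>,
  named so that existence and uniqueness can be treated separately.\<close>

definition calculus_limit ::
    "('a::chilbert_space \<Rightarrow> 'a) \<Rightarrow> (complex \<Rightarrow> complex) \<Rightarrow> ('a \<Rightarrow> 'a) \<Rightarrow> bool" where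
  "calculus_limit Q h S \<longleftrightarrow> bounded_clinear S \<and>
     (\<exists>P. uniform_limit (op_spectrum Q) (\<lambda>n. poly (P n)) h sequentially \<and>
          (\<lambda>n. onorm (\<lambda>x. poly_op (P n) Q x - S x)) \<longlonglongrightarrow> 0)"

text \<open>Self-adjointness is encoded by the realness of the quadratic form; polarization turns it
  into \<open>symmetric\<close>.\<close>

locale self_adjoint_op =
  fixes Q :: "'a::chilbert_space \<Rightarrow> 'a"
  assumes bounded_clinear: "bounded_clinear Q"
    and cinner_real: "cinner (Q x) x \<in> \<real>"
begin

lemma symmetric: "cinner (Q x) y = cinner x (Q y)"
  using bounded_clinear cinner_real by (rule symmetric_if_cinner_real)

text \<open>\<open>Q\<close> moves across the inner product unchanged while scalars are conjugated.
  In particular, polynomials with real coefficients give symmetric operators.\<close>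

lemma cinner_poly_op: "cinner (poly_op p Q x) y = cinner x (poly_op (map_poly cnj p) Q y)"
proof (induction p arbitrary: x y)
  case (pCons a p)
  thus ?case
    by (simp add: poly_op_pCons map_poly_pCons cinner_simps symmetric
        poly_op_commute[OF bounded_clinear])
qed simp

section \<open>Location of the spectrum and the norm bound for polynomials\<close>

lemma spectrum_real:
  assumes z: "z \<in> op_spectrum Q" shows "z \<in> \<real>"
proof (rule ccontr)
  assume "z \<notin> \<real>"
  hence im: "Im z \<noteq> 0" by (simp add: complex_is_Real_iff)
  \<comment> \<open>As \<open>Q\<close> has a real form, the form of \<open>Q - z\<close> has
    imaginary part \<open>- Im z * (norm x)\<^sup>2\<close>. The factor \<open>u\<close> turns it
    into a positive real part, and coercivity applies.\<close>
  define u where "u = \<i> * complex_of_real (sgn (Im z))"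
  have "op_invertible (\<lambda>x. u *\<^sub>C (Q x - z *\<^sub>C x))"
  proof (rule op_invertible_if_coercive)
    show "bounded_clinear (\<lambda>x. u *\<^sub>C (Q x - z *\<^sub>C x))"
      by (intro bounded_clinear_scaleC bounded_clinear_diff bounded_clinear bounded_clinear_id)
    show "\<bar>Im z\<bar> * (norm x)\<^sup>2 \<le> Re (cinner (u *\<^sub>C (Q x - z *\<^sub>C x)) x)" for x
    proof -
      have "Im (cinner (Q x) x) = 0" using cinner_real[of x] by (simp add: complex_is_Real_iff)
      thus ?thesis
        by (simp add: cinner_simps u_def cinner_self abs_sgn mult_ac del: of_real_power)
    qed
  qed (use im in simp)
  hence "op_invertible (\<lambda>x. Q x - z *\<^sub>C x)"
    by (rule op_invertible_scaleC_cancel) (use im in \<open>simp add: u_def sgn_if\<close>)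
  thus False using z by (simp add: op_spectrum_iff)
qed

text \<open>For \<open>t < m\<close> the operator \<open>Q - t\<close> is coercive with constant
  \<open>m - t\<close>, hence invertible.\<close>

lemma spectrum_ge:
  assumes m: "\<And>x. m * (norm x)\<^sup>2 \<le> Re (cinner (Q x) x)" and z: "complex_of_real t \<in> op_spectrum Q"
  shows "m \<le> t"
proof (rule ccontr)
  assume "\<not> m \<le> t"
  have "op_invertible (\<lambda>x. Q x - complex_of_real t *\<^sub>C x)"
  proof (rule op_invertible_if_coercive[of _ "m - t"])
    show "bounded_clinear (\<lambda>x. Q x - complex_of_real t *\<^sub>C x)"
      by (intro bounded_clinear_scaleC bounded_clinear_diff bounded_clinear bounded_clinear_id)
    show "(m - t) * (norm x)\<^sup>2 \<le> Re (cinner (Q x - complex_of_real t *\<^sub>C x) x)" for x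
      using m[of x] by (simp add: cinner_simps left_diff_distrib)
  qed (use \<open>\<not> m \<le> t\<close> in simp)
  thus False using z by (simp add: op_spectrum_iff)
qed

lemma spectrum_le:
  assumes M: "\<And>x. Re (cinner (Q x) x) \<le> M * (norm x)\<^sup>2" and z: "complex_of_real t \<in> op_spectrum Q"
  shows "t \<le> M"
proof (rule ccontr)
  assume "\<not> t \<le> M"
  \<comment> \<open>Here \<open>t - Q\<close> is the coercive operator, so the sign is changed
    first.\<close>
  have "op_invertible (\<lambda>x. (- 1) *\<^sub>C (Q x - complex_of_real t *\<^sub>C x))"
  proof (rule op_invertible_if_coercive[of _ "t - M"])
    show "bounded_clinear (\<lambda>x. (- 1) *\<^sub>C (Q x - complex_of_real t *\<^sub>C x))"
      by (intro bounded_clinear_scaleC bounded_clinear_diff bounded_clinear bounded_clinear_id)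
    show "(t - M) * (norm x)\<^sup>2 \<le> Re (cinner ((- 1) *\<^sub>C (Q x - complex_of_real t *\<^sub>C x)) x)" for x
      using M[of x] by (simp add: cinner_simps left_diff_distrib)
  qed (use \<open>\<not> t \<le> M\<close> in simp)
  hence "op_invertible (\<lambda>x. Q x - complex_of_real t *\<^sub>C x)"
    by (rule op_invertible_scaleC_cancel) simp
  thus False using z by (simp add: op_spectrum_iff)
qed

text \<open>
  With \<open>N = \<parallel>p(Q)\<parallel>\<close>, the positive operator \<open>N\<^sup>2 - p(Q)* p(Q)\<close> is not coercive, hence not
  invertible, hence the polynomial \<open>cnj p * p - N\<^sup>2\<close> has a root in the spectrum.
\<close>

lemma spectrum_attains_norm:
  fixes p :: "complex poly"
  defines "N \<equiv> onorm (poly_op p Q)"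
  defines "q \<equiv> map_poly cnj p * p - [:complex_of_real (N\<^sup>2):]"
  assumes "q \<noteq> 0" "N > 0"
  obtains z where "z \<in> op_spectrum Q" "poly q z = 0"
proof -
  note bp = bounded_clinear_poly_op[OF bounded_clinear]
  have "\<not> op_invertible (poly_op q Q)"
  proof
    assume inv: "op_invertible (poly_op q Q)"
    \<comment> \<open>The operator \<open>N\<^sup>2 - p(Q)* p(Q)\<close>. It is positive by the
      choice of \<open>N\<close>, and invertibility would make it bounded below, hence
      coercive.\<close>
    define B where "B = (\<lambda>x. (- 1) *\<^sub>C poly_op q Q x)"
    have B: "cinner (B x) x = complex_of_real (N\<^sup>2 * (norm x)\<^sup>2 - (norm (poly_op p Q x))\<^sup>2)" for x
    proof -
      have "cinner x (poly_op (map_poly cnj p) Q (poly_op p Q x))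
          = cinner (poly_op p Q x) (poly_op p Q x)"
        by (rule cinner_poly_op[symmetric])
      hence "cinner (poly_op (map_poly cnj p) Q (poly_op p Q x)) x
          = cinner (poly_op p Q x) (poly_op p Q x)"
        by (metis cinner_commute)
      thus ?thesis
        by (simp add: B_def q_def poly_op_diff poly_op_mult[OF bounded_clinear] poly_op_pCons
            cinner_simps cinner_self)
    qed
    have le: "norm (poly_op p Q x) \<le> N * norm x" for x
      unfolding N_def by (intro onorm bounded_clinearD bp)
    obtain \<alpha> where \<alpha>: "\<alpha> > 0" "\<And>x. \<alpha> * norm x \<le> norm (poly_op q Q x)"
      using op_invertible_bounded_below[OF inv] by blast
    obtain c where c: "c > 0" "\<And>x. c * (norm x)\<^sup>2 \<le> Re (cinner (B x) x)"
    proof (rule coercive_if_bounded_below)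
      show "bounded_clinear B"
        unfolding B_def by (intro bounded_clinear_scaleC bp)
      show "cinner (B x) x \<in> \<real>\<^sub>\<ge>\<^sub>0" for x
        using power_mono[OF le[of x], of 2]
        unfolding B nonneg_Reals_of_real_iff by (simp add: power_mult_distrib)
      show "\<alpha> * norm x \<le> norm (B x)" for x
        using \<alpha>(2)[of x] by (simp add: B_def)
    qed (use \<alpha> in blast)+
    \<comment> \<open>Coercivity of \<open>B\<close> would give \<open>p(Q)\<close> the bound
      \<open>sqrt d\<close>, which is smaller than its norm \<open>N\<close>. The maximum covers the
      case \<open>c > N\<^sup>2\<close>.\<close>
    define d where "d = max 0 (N\<^sup>2 - c)"
    have "norm (poly_op p Q x) \<le> sqrt d * norm x" for x
    proof (rule power2_le_imp_le)
      have "(norm (poly_op p Q x))\<^sup>2 \<le> (N\<^sup>2 - c) * (norm x)\<^sup>2"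
        using c(2)[of x] by (simp add: B left_diff_distrib del: of_real_diff)
      also have "\<dots> \<le> d * (norm x)\<^sup>2"
        by (intro mult_right_mono) (auto simp: d_def)
      finally show "(norm (poly_op p Q x))\<^sup>2 \<le> (sqrt d * norm x)\<^sup>2"
        by (simp add: power_mult_distrib d_def)
    qed (simp add: d_def)
    hence "N \<le> sqrt d"
      unfolding N_def by (intro onorm_bound) (auto simp: d_def)
    hence "N\<^sup>2 \<le> (sqrt d)\<^sup>2"
      using \<open>N > 0\<close> by (intro power_mono) auto
    hence "N\<^sup>2 \<le> d"
      by (simp add: d_def)
    moreover have "d < N\<^sup>2"
      using c(1) \<open>N > 0\<close> by (simp add: d_def)
    ultimately show False by simp
  qed
  thus ?thesis
    using op_invertible_poly_op[OF bounded_clinear \<open>q \<noteq> 0\<close>] that by blast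
qed

text \<open>A nonzero \<open>Q\<close> is handled by norm attainment for the polynomial
  \<open>X\<close>. The vector \<open>x\<close> excludes the trivial space, on which every operator
  is invertible.\<close>

lemma spectrum_nonempty:
  assumes "(x :: 'a) \<noteq> 0" shows "op_spectrum Q \<noteq> {}"
proof (cases "Q = (\<lambda>_. 0)")
  case True
  have "0 \<in> op_spectrum Q"
    using assms by (auto simp: op_spectrum_iff True elim!: op_invertibleE)
  thus ?thesis by blast
next
  case False
  let ?X = "[:0, 1:] :: complex poly"
  have X: "poly_op ?X Q = Q"
    by (simp add: fun_eq_iff poly_op_pCons)
  have "onorm Q > 0"
    using onorm_pos_lt[OF bounded_clinearD(1)[OF bounded_clinear]] False by (auto simp: fun_eq_iff)
  thus ?thesis
    using spectrum_attains_norm[of ?X] unfolding X by (force simp: map_poly_pCons)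
qed

text \<open>On the real spectrum \<open>q\<close> takes the value
  \<open>|p(z)|\<^sup>2 - N\<^sup>2\<close>, so a spectral root of \<open>q\<close> is a point where
  \<open>|p|\<close> equals the operator norm.\<close>

lemma norm_poly_op_le:
  assumes \<epsilon>: "\<epsilon> \<ge> 0" "\<And>z. z \<in> op_spectrum Q \<Longrightarrow> cmod (poly p z) \<le> \<epsilon>"
  shows "onorm (poly_op p Q) \<le> \<epsilon>"
proof (rule ccontr)
  define N where "N = onorm (poly_op p Q)"
  define q where "q = map_poly cnj p * p - [:complex_of_real (N\<^sup>2):]"
  assume "\<not> onorm (poly_op p Q) \<le> \<epsilon>"
  hence N: "N > \<epsilon>" "N > 0" using \<epsilon>(1) by (auto simp: N_def)
  have "poly_op p Q \<noteq> (\<lambda>_. 0)"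
    using N(2) onorm_zero unfolding N_def by (metis less_irrefl)
  then obtain x where "poly_op p Q x \<noteq> 0"
    by (auto simp: fun_eq_iff)
  hence "x \<noteq> 0"
    using bounded_clinearD(4)[OF bounded_clinear_poly_op[OF bounded_clinear]] by metis
  obtain z where z: "z \<in> op_spectrum Q" "poly q z = 0"
  proof (cases "q = 0")
    \<comment> \<open>If \<open>q\<close> vanishes identically, any spectral point is a
      root.\<close>
    case True
    thus ?thesis using spectrum_nonempty[OF \<open>x \<noteq> 0\<close>] that by force
  next
    case False
    thus ?thesis
      using spectrum_attains_norm[of p] N(2) that unfolding N_def q_def by blast
  qed
  have "cnj z = z" using spectrum_real[OF z(1)] by (simp add: Reals_cnj_iff)
  hence "complex_of_real ((cmod (poly p z))\<^sup>2) = complex_of_real (N\<^sup>2)"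
    using z(2) by (simp add: q_def complex_mult_cnj_cmod mult.commute[of "cnj _"])
  hence "(cmod (poly p z))\<^sup>2 = N\<^sup>2"
    by (simp only: of_real_eq_iff)
  hence "cmod (poly p z) = N"
    using N(2) by simp
  thus False using \<epsilon>(2)[OF z(1)] N(1) by simp
qed


section \<open>Uniqueness, products and existence of limits of polynomials in
  \<open>Q\<close>\<close>

lemma calculus_limit_iff:
  "calculus_limit Q h S \<longleftrightarrow> bounded_clinear S \<and>
     (\<exists>P. uniform_limit (op_spectrum Q) (\<lambda>n. poly (P n)) h sequentially \<and>
          (\<lambda>n. Blinfun (poly_op (P n) Q)) \<longlonglongrightarrow> Blinfun S)"
proof -
  \<comment> \<open>The error in \<open>calculus_limit\<close> is a distance in the Banach space of
    bounded operators, whose limit rules and completeness become available.\<close>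
  have "norm (Blinfun (poly_op p Q) - Blinfun S) = onorm (\<lambda>x. poly_op p Q x - S x)"
    if "bounded_clinear S" for S p
    by (simp add: norm_blinfun.rep_eq minus_blinfun.rep_eq bounded_linear_Blinfun_apply
        bounded_clinearD(1)[OF that] bounded_clinearD(1)[OF bounded_clinear_poly_op[OF bounded_clinear]])
  thus ?thesis
    unfolding calculus_limit_def LIM_zero_iff[of _ "Blinfun S", symmetric]
      tendsto_norm_zero_iff[of "\<lambda>n. _ n - Blinfun S", symmetric]
    by auto
qed

lemma Blinfun_poly_op_apply [simp]: "blinfun_apply (Blinfun (poly_op p Q)) = poly_op p Q"
  by (rule bounded_linear_Blinfun_apply)
     (rule bounded_clinearD(1)[OF bounded_clinear_poly_op[OF bounded_clinear]])

lemma Blinfun_poly_op_diff: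
  "Blinfun (poly_op (p - q) Q) = Blinfun (poly_op p Q) - Blinfun (poly_op q Q)"
  by (rule blinfun_eqI) (simp add: blinfun.diff_left poly_op_diff)

lemma Blinfun_poly_op_mult:
  "Blinfun (poly_op (p * q) Q) = Blinfun (poly_op p Q) o\<^sub>L Blinfun (poly_op q Q)"
  by (rule blinfun_eqI) (simp add: poly_op_mult[OF bounded_clinear])

lemma norm_Blinfun_poly_op_le:
  assumes "\<epsilon> \<ge> 0" "\<And>z. z \<in> op_spectrum Q \<Longrightarrow> cmod (poly p z) \<le> \<epsilon>"
  shows "norm (Blinfun (poly_op p Q)) \<le> \<epsilon>"
  using norm_poly_op_le[OF assms] by (simp add: norm_blinfun.rep_eq)

text \<open>The difference of two approximating sequences tends to 0 uniformly on the spectrum,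
  hence in operator norm by \<open>norm_Blinfun_poly_op_le\<close>.\<close>

lemma calculus_limit_unique:
  assumes "calculus_limit Q h S" "calculus_limit Q h S'"
  shows "S = S'"
proof -
  obtain P where S: "bounded_clinear S"
    and P: "uniform_limit (op_spectrum Q) (\<lambda>n. poly (P n)) h sequentially"
      "(\<lambda>n. Blinfun (poly_op (P n) Q)) \<longlonglongrightarrow> Blinfun S"
    using assms(1) by (auto simp: calculus_limit_iff)
  obtain P' where S': "bounded_clinear S'"
    and P': "uniform_limit (op_spectrum Q) (\<lambda>n. poly (P' n)) h sequentially"
      "(\<lambda>n. Blinfun (poly_op (P' n) Q)) \<longlonglongrightarrow> Blinfun S'"
    using assms(2) by (auto simp: calculus_limit_iff)
  have "(\<lambda>n. Blinfun (poly_op (P n - P' n) Q)) \<longlonglongrightarrow> 0"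
  proof (rule LIMSEQ_I)
    fix r :: real assume "r > 0"
    have "uniform_limit (op_spectrum Q) (\<lambda>n. poly (P n - P' n)) (\<lambda>_. 0) sequentially"
      using uniform_limit_minus[OF P(1) P'(1)] by (simp add: poly_diff[abs_def])
    then obtain N where "\<forall>n\<ge>N. \<forall>z\<in>op_spectrum Q. cmod (poly (P n - P' n) z) < r / 2"
      using \<open>r > 0\<close> unfolding uniform_limit_sequentially_iff dist_norm diff_zero
      by (meson half_gt_zero)
    hence "norm (Blinfun (poly_op (P n - P' n) Q)) \<le> r / 2" if "n \<ge> N" for n
      using that \<open>r > 0\<close> by (intro norm_Blinfun_poly_op_le) (auto intro: less_imp_le)
    thus "\<exists>N. \<forall>n\<ge>N. norm (Blinfun (poly_op (P n - P' n) Q) - 0) < r"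
      using \<open>r > 0\<close> by (force intro!: exI[of _ N])
  qed
  moreover have "(\<lambda>n. Blinfun (poly_op (P n - P' n) Q)) \<longlonglongrightarrow> Blinfun S - Blinfun S'"
    unfolding Blinfun_poly_op_diff by (intro tendsto_diff P P')
  ultimately have "Blinfun S = Blinfun S'"
    using LIMSEQ_unique by fastforce
  thus ?thesis
    by (metis S S' bounded_clinearD(1) bounded_linear_Blinfun_apply)
qed

lemma functional_calculus_eqI:
  assumes "calculus_limit Q h S" shows "functional_calculus Q h = S"
proof -
  have "functional_calculus Q h = (THE S. calculus_limit Q h S)"
    by (simp add: functional_calculus_def calculus_limit_def)
  also have "\<dots> = S"
    using assms calculus_limit_unique by blast
  finally show ?thesis .
qed

lemma calculus_limit_poly: "calculus_limit Q (poly p) (poly_op p Q)"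
  unfolding calculus_limit_iff
  by (intro conjI exI[of _ "\<lambda>_. p"] tendsto_const bounded_clinear_poly_op bounded_clinear
      uniform_limit_const)

lemma calculus_limit_cong:
  assumes "calculus_limit Q h S" "\<And>z. z \<in> op_spectrum Q \<Longrightarrow> h z = h' z"
  shows "calculus_limit Q h' S"
proof -
  have "uniform_limit (op_spectrum Q) f h sequentially
      \<longleftrightarrow> uniform_limit (op_spectrum Q) f h' sequentially" for f :: "nat \<Rightarrow> complex \<Rightarrow> complex"
    by (rule uniform_limit_cong') (auto simp: assms(2))
  thus ?thesis using assms(1) by (simp add: calculus_limit_def)
qed

text \<open>Multiplicativity passes from polynomials to limits. The boundedness assumptions make the
  product of the uniform limits a uniform limit.\<close>

lemma calculus_limit_mult:
  assumes "calculus_limit Q h S" "calculus_limit Q h' S'"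
    and bdd: "bounded (h ` op_spectrum Q)" "bounded (h' ` op_spectrum Q)"
  shows "calculus_limit Q (\<lambda>z. h z * h' z) (S \<circ> S')"
proof -
  obtain P where S: "bounded_clinear S"
    and P: "uniform_limit (op_spectrum Q) (\<lambda>n. poly (P n)) h sequentially"
      "(\<lambda>n. Blinfun (poly_op (P n) Q)) \<longlonglongrightarrow> Blinfun S"
    using assms(1) by (auto simp: calculus_limit_iff)
  obtain P' where S': "bounded_clinear S'"
    and P': "uniform_limit (op_spectrum Q) (\<lambda>n. poly (P' n)) h' sequentially"
      "(\<lambda>n. Blinfun (poly_op (P' n) Q)) \<longlonglongrightarrow> Blinfun S'"
    using assms(2) by (auto simp: calculus_limit_iff)
  have SS: "bounded_clinear (S \<circ> S')"
    using S S' by (rule bounded_clinear_comp)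
  have "Blinfun S o\<^sub>L Blinfun S' = Blinfun (S \<circ> S')"
    by (rule blinfun_eqI)
       (simp add: bounded_linear_Blinfun_apply[OF bounded_clinearD(1)] S S' SS)
  moreover have "(\<lambda>n. Blinfun (poly_op (P n * P' n) Q)) \<longlonglongrightarrow> (Blinfun S o\<^sub>L Blinfun S')"
    unfolding Blinfun_poly_op_mult
    by (intro bounded_bilinear.tendsto[OF bounded_bilinear_blinfun_compose] P P')
  moreover have "uniform_limit (op_spectrum Q) (\<lambda>n. poly (P n * P' n)) (\<lambda>z. h z * h' z) sequentially"
    using uniform_lim_mult[OF P(1) P'(1) bdd] by (simp add: poly_mult[abs_def])
  ultimately show ?thesis
    unfolding calculus_limit_iff using SS by (auto intro!: exI[of _ "\<lambda>n. P n * P' n"])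
qed

text \<open>
  Real-valued functions are approximated by polynomials with real coefficients, whose values at
  \<open>Q\<close> are symmetric.
\<close>

lemma calculus_limit_exists:
  fixes g :: "real \<Rightarrow> real"
  assumes spec: "op_spectrum Q \<subseteq> complex_of_real ` {a..b}"
    and g: "continuous_on {a..b} g" and h: "\<And>x. x \<in> {a..b} \<Longrightarrow> h (complex_of_real x) = complex_of_real (g x)"
  obtains S where "calculus_limit Q h S" "\<And>x y. cinner (S x) y = cinner x (S y)"
proof -
  have "\<exists>p. map_poly cnj p = p \<and> (\<forall>z\<in>op_spectrum Q. cmod (poly p z - h z) < 1 / real (Suc n))" for n
  proof -
    obtain f where f: "real_polynomial_function f" "\<And>x. x \<in> {a..b} \<Longrightarrow> \<bar>g x - f x\<bar> < 1 / real (Suc n)"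
      using Stone_Weierstrass_real_polynomial_function[OF compact_Icc g, of "1 / real (Suc n)"] by auto
    obtain c k where ck: "f = (\<lambda>x. \<Sum>i\<le>k. c i * x ^ i)"
      using f(1) by (auto simp: real_polynomial_function_iff_sum)
    define p where "p = (\<Sum>i\<le>k. monom (complex_of_real (c i)) i)"
    have "coeff (map_poly cnj p) i = coeff p i" for i
      by (simp add: p_def coeff_map_poly coeff_sum)
    \<comment> \<open>The coefficients are real; this later makes the limit operator
      symmetric.\<close>
    hence "map_poly cnj p = p"
      by (rule poly_eqI)
    moreover have "cmod (poly p z - h z) < 1 / real (Suc n)" if z: "z \<in> op_spectrum Q" for z
    proof -
      obtain x where x: "z = complex_of_real x" "x \<in> {a..b}" using spec z by blast
      have "poly p z - h z = complex_of_real (f x - g x)"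
        by (simp add: p_def ck x(1) h[OF x(2)] poly_sum poly_monom)
      thus ?thesis using f(2)[OF x(2)] by (simp only: norm_of_real abs_minus_commute)
    qed
    ultimately show ?thesis by blast
  qed
  then obtain P where P: "\<And>n. map_poly cnj (P n) = P n"
    "\<And>n z. z \<in> op_spectrum Q \<Longrightarrow> cmod (poly (P n) z - h z) < 1 / real (Suc n)"
    by metis
  have unif: "uniform_limit (op_spectrum Q) (\<lambda>n. poly (P n)) h sequentially"
  proof (rule uniform_limitI)
    fix \<epsilon> :: real assume "\<epsilon> > 0"
    hence "\<forall>\<^sub>F n in sequentially. 1 / real (Suc n) < \<epsilon>"
      using lim_inverse_n' LIMSEQ_Suc order_tendstoD(2) by blast
    thus "\<forall>\<^sub>F n in sequentially. \<forall>z\<in>op_spectrum Q. dist (poly (P n) z) (h z) < \<epsilon>"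
      by eventually_elim (auto simp: dist_norm simp del: of_nat_Suc intro: less_trans[OF P(2)])
  qed
  \<comment> \<open>The norm bound turns uniform closeness of the polynomials on the spectrum into
    closeness of the operators.\<close>
  have "Cauchy (\<lambda>n. Blinfun (poly_op (P n) Q))"
  proof (rule metric_CauchyI)
    fix \<epsilon> :: real assume \<epsilon>: "\<epsilon> > 0"
    then obtain N where N: "\<And>n z. n \<ge> N \<Longrightarrow> z \<in> op_spectrum Q \<Longrightarrow> dist (poly (P n) z) (h z) < \<epsilon> / 4"
      using unif unfolding uniform_limit_sequentially_iff by (metis zero_less_divide_iff zero_less_numeral)
    have "dist (Blinfun (poly_op (P m) Q)) (Blinfun (poly_op (P n) Q)) < \<epsilon>" if "m \<ge> N" "n \<ge> N" for m n
    proof -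
      have "norm (Blinfun (poly_op (P m - P n) Q)) \<le> \<epsilon> / 2"
      proof (rule norm_Blinfun_poly_op_le)
        fix z assume z: "z \<in> op_spectrum Q"
        show "cmod (poly (P m - P n) z) \<le> \<epsilon> / 2"
          using N[OF that(1) z] N[OF that(2) z] dist_triangle2[of "poly (P m) z" "poly (P n) z" "h z"]
          by (simp add: dist_norm)
      qed (use \<epsilon> in simp)
      thus ?thesis using \<epsilon> by (simp add: dist_norm Blinfun_poly_op_diff)
    qed
    thus "\<exists>N. \<forall>m\<ge>N. \<forall>n\<ge>N. dist (Blinfun (poly_op (P m) Q)) (Blinfun (poly_op (P n) Q)) < \<epsilon>"
      by blast
  qed
  then obtain L where L: "(\<lambda>n. Blinfun (poly_op (P n) Q)) \<longlonglongrightarrow> L"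
    using Cauchy_convergent convergent_def by blast
  have lim: "(\<lambda>n. poly_op (P n) Q x) \<longlonglongrightarrow> blinfun_apply L x" for x
    using blinfun.tendsto[OF L tendsto_const[of x]] by simp
  \<comment> \<open>The type of \<open>L\<close> records real linearity; complex homogeneity is
    inherited from the pointwise limits.\<close>
  have "blinfun_apply L (c *\<^sub>C x) = c *\<^sub>C blinfun_apply L x" for c x
    using lim[of "c *\<^sub>C x"] tendsto_scaleC[OF lim[of x], of c]
    by (simp add: bounded_clinearD(6)[OF bounded_clinear_poly_op[OF bounded_clinear]]
        LIMSEQ_unique)
  hence "bounded_clinear (blinfun_apply L)"
    by (simp add: bounded_clinear_def blinfun.bounded_linear_right)
  hence "calculus_limit Q h (blinfun_apply L)"
    unfolding calculus_limit_iff using unif L by (auto simp: blinfun_apply_inverse)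
  moreover have "cinner (blinfun_apply L x) y = cinner x (blinfun_apply L y)" for x y
  proof (rule LIMSEQ_unique)
    show "(\<lambda>n. cinner (poly_op (P n) Q x) y) \<longlonglongrightarrow> cinner (blinfun_apply L x) y"
      by (intro tendsto_cinner lim tendsto_const)
    show "(\<lambda>n. cinner (poly_op (P n) Q x) y) \<longlonglongrightarrow> cinner x (blinfun_apply L y)"
      unfolding cinner_poly_op P(1) by (intro tendsto_cinner lim tendsto_const)
  qed
  ultimately show ?thesis using that by blast
qed

end

section \<open>Real powers of positive operators bounded below\<close>

text \<open>Cauchy-Schwarz turns a lower bound on the form into one on \<open>norm (Q x)\<close>,
  and self-adjointness follows by polarization.\<close>

lemma pos_bounded_belowI:
  assumes "bounded_clinear Q" "\<And>x. cinner (Q x) x \<in> \<real>\<^sub>\<ge>\<^sub>0"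
    "c > 0" "\<And>x. c * (norm x)\<^sup>2 \<le> Re (cinner (Q x) x)"
  shows "pos_bounded_below Q"
proof -
  interpret self_adjoint_op Q
    using assms(1,2) nonneg_Reals_subset_Reals by unfold_locales auto
  have "c * norm x \<le> norm (Q x)" for x
  proof (cases "x = 0")
    case False
    have "c * (norm x)\<^sup>2 \<le> norm (Q x) * norm x"
      using assms(4)[of x] complex_Re_le_cmod[of "cinner (Q x) x"]
        cinner_Cauchy_Schwarz[of "Q x" x] by linarith
    thus ?thesis using False by (simp add: power2_eq_square)
  qed simp
  moreover have "cadjoint Q = Q"
    by (rule cadjoint_eqI) (rule symmetric)
  ultimately show ?thesis
    unfolding pos_bounded_below_def using assms by blast
qed

locale pos_bounded_below_op =
  fixes Q :: "'a::chilbert_space \<Rightarrow> 'a"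
  assumes pos_bounded_below: "pos_bounded_below Q"
begin

sublocale self_adjoint_op Q
  using pos_bounded_below nonneg_Reals_subset_Reals
  by unfold_locales (auto simp: pos_bounded_below_def)

lemma coercive:
  obtains c where "c > 0" "\<And>x. c * (norm x)\<^sup>2 \<le> Re (cinner (Q x) x)"
proof -
  obtain \<alpha> where \<alpha>: "\<alpha> > 0" "\<And>x. \<alpha> * norm x \<le> norm (Q x)"
    using pos_bounded_below by (auto simp: pos_bounded_below_def)
  show ?thesis
  proof (rule coercive_if_bounded_below[OF bounded_clinear])
    show "cinner (Q x) x \<in> \<real>\<^sub>\<ge>\<^sub>0" for x
      using pos_bounded_below by (simp add: pos_bounded_below_def)
  qed (use \<alpha> that in blast)+
qed

lemma bounded_form:
  obtains M where "M > 0" "\<And>x. Re (cinner (Q x) x) \<le> M * (norm x)\<^sup>2"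
proof -
  obtain M where M: "M > 0" "\<And>x. norm (Q x) \<le> M * norm x"
    using bounded_clinear_pos_bound[OF bounded_clinear] by blast
  have "Re (cinner (Q x) x) \<le> M * (norm x)\<^sup>2" for x
  proof -
    have "Re (cinner (Q x) x) \<le> norm (Q x) * norm x"
      using cinner_Cauchy_Schwarz complex_Re_le_cmod order_trans by blast
    also have "\<dots> \<le> (M * norm x) * norm x"
      by (intro mult_right_mono M) simp
    finally show ?thesis by (simp add: power2_eq_square mult.assoc)
  qed
  thus ?thesis using that M(1) by blast
qed

text \<open>The positive left end makes every real power, also a negative one, continuous on an
  interval around the spectrum.\<close>

lemma spectrum_subset:
  obtains a b where "a > 0" "op_spectrum Q \<subseteq> complex_of_real ` {a..b}"
proof -
  obtain a where a: "a > 0" "\<And>x. a * (norm x)\<^sup>2 \<le> Re (cinner (Q x) x)"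
    using coercive by blast
  obtain b where b: "b > 0" "\<And>x. Re (cinner (Q x) x) \<le> b * (norm x)\<^sup>2"
    using bounded_form by blast
  have "z \<in> complex_of_real ` {a..b}" if z: "z \<in> op_spectrum Q" for z
  proof -
    obtain t where "z = complex_of_real t" using spectrum_real[OF z] by (rule Reals_cases)
    thus ?thesis using spectrum_ge[OF a(2)] spectrum_le[OF b(2)] z by auto
  qed
  thus ?thesis using that a(1) by blast
qed

text \<open>One witness \<open>S\<close> serves both claims: existence provides it with its
  symmetry, and uniqueness identifies it with \<open>op_powr Q r\<close>.\<close>

lemma op_powr_limit:
  "calculus_limit Q (\<lambda>z. z powr complex_of_real r) (op_powr Q r)"
  and symmetric_op_powr: "cinner (op_powr Q r x) y = cinner x (op_powr Q r y)"
proof -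
  obtain a b where ab: "a > 0" "op_spectrum Q \<subseteq> complex_of_real ` {a..b}"
    using spectrum_subset by blast
  obtain S where S: "calculus_limit Q (\<lambda>z. z powr complex_of_real r) S"
    "\<And>x y. cinner (S x) y = cinner x (S y)"
  proof (rule calculus_limit_exists[OF ab(2), of "\<lambda>x. x powr r" "\<lambda>z. z powr complex_of_real r"])
    show "continuous_on {a..b} (\<lambda>x. x powr r)"
      by (intro continuous_intros) (use ab in auto)
    show "complex_of_real x powr complex_of_real r = complex_of_real (x powr r)" if "x \<in> {a..b}" for x
      using ab(1) that by (simp add: powr_of_real)
  qed blast
  moreover have "op_powr Q r = S"
    unfolding op_powr_def by (rule functional_calculus_eqI[OF S(1)])
  ultimately show "calculus_limit Q (\<lambda>z. z powr complex_of_real r) (op_powr Q r)"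
    "cinner (op_powr Q r x) y = cinner x (op_powr Q r y)"
    by auto
qed

lemma bounded_clinear_op_powr: "bounded_clinear (op_powr Q r)"
  using op_powr_limit by (simp add: calculus_limit_def)

text \<open>Provides the boundedness required by \<open>calculus_limit_mult\<close>, by compactness
  of an interval away from 0.\<close>

lemma bounded_powr_spectrum: "bounded ((\<lambda>z. z powr complex_of_real r) ` op_spectrum Q)"
proof -
  obtain a b where ab: "a > 0" "op_spectrum Q \<subseteq> complex_of_real ` {a..b}"
    using spectrum_subset by blast
  have "continuous_on (complex_of_real ` {a..b}) (\<lambda>z. z powr complex_of_real r)"
    by (intro continuous_intros) (use ab(1) in \<open>auto simp: complex_nonpos_Reals_iff\<close>)
  moreover have "compact (complex_of_real ` {a..b})"
    by (intro compact_continuous_image continuous_intros) auto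
  ultimately have "bounded ((\<lambda>z. z powr complex_of_real r) ` complex_of_real ` {a..b})"
    by (rule compact_imp_bounded[OF compact_continuous_image])
  thus ?thesis
    by (rule bounded_subset) (use ab(2) in blast)
qed

lemma op_powr_add: "op_powr Q (r + s) x = op_powr Q r (op_powr Q s x)"
proof -
  have "calculus_limit Q (\<lambda>z. z powr complex_of_real r * z powr complex_of_real s)
      (op_powr Q r \<circ> op_powr Q s)"
    by (intro calculus_limit_mult op_powr_limit bounded_powr_spectrum)
  hence "calculus_limit Q (\<lambda>z. z powr complex_of_real (r + s)) (op_powr Q r \<circ> op_powr Q s)"
    by (rule calculus_limit_cong) (simp add: powr_add)
  thus ?thesis
    using calculus_limit_unique[OF op_powr_limit] by (metis comp_apply)
qed

lemma op_powr_0: "op_powr Q 0 x = x"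
proof -
  obtain a b where ab: "a > 0" "op_spectrum Q \<subseteq> complex_of_real ` {a..b}"
    using spectrum_subset by blast
  have "calculus_limit Q (\<lambda>z. z powr complex_of_real 0) (poly_op 1 Q)"
    \<comment> \<open>The spectrum avoids 0, where \<open>0 powr 0\<close> is 0 by convention and
      not 1.\<close>
    by (rule calculus_limit_cong[OF calculus_limit_poly]) (use ab in auto)
  hence "op_powr Q 0 = poly_op 1 Q"
    by (rule calculus_limit_unique[OF op_powr_limit])
  thus ?thesis by (simp add: poly_op_def)
qed

lemma op_powr_1: "op_powr Q 1 x = Q x"
proof -
  have "calculus_limit Q (\<lambda>z. z powr complex_of_real 1) (poly_op [:0, 1:] Q)"
    by (rule calculus_limit_cong[OF calculus_limit_poly]) simp
  hence "op_powr Q 1 = poly_op [:0, 1:] Q"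
    by (rule calculus_limit_unique[OF op_powr_limit])
  thus ?thesis by (simp add: poly_op_pCons)
qed

end

section \<open>Characterization of biframes\<close>

lemma biframe_imp_factorization:
  fixes e F G :: "nat \<Rightarrow> 'a::chilbert_space"
  assumes e: "orthonormal_basis e" and rt: "r + t = 1"
    and F: "bessel_sequence F" and G: "bessel_sequence G" and "biframe F G"
  shows "\<exists>Q T W :: 'a \<Rightarrow> 'a.
       pos_bounded_below Q \<and> bounded_clinear T \<and> bounded_clinear W \<and>
       T \<circ> cadjoint W = id \<and>
       (\<forall>k. F k = op_powr Q r (W (e k)) \<and> G k = op_powr Q t (T (e k)))"
proof -
  define U where "U = analysis_op e F"
  define V where "V = analysis_op e G"
  have U: "bounded_clinear U" and V: "bounded_clinear V"
    unfolding U_def V_def by (intro bounded_clinear_analysis_op e F G)+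
  note U' = bounded_clinear_cadjoint[OF e U] and V' = bounded_clinear_cadjoint[OF e V]
  \<comment> \<open>The quadratic form of this operator at \<open>f\<close> is the biframe series of
    \<open>f\<close>, so the lower biframe bound becomes coercivity.\<close>
  define Q where "Q = cadjoint V \<circ> U"
  obtain A where A: "A > 0" "\<And>f. \<exists>s::real. (\<lambda>k. cinner f (F k) * cinner (G k) f) sums complex_of_real s
      \<and> A * (norm f)\<^sup>2 \<le> s"
    using \<open>biframe F G\<close> unfolding biframe_def by blast
  have form: "\<exists>s. cinner (Q f) f = complex_of_real s \<and> A * (norm f)\<^sup>2 \<le> s" for f
  proof -
    obtain s where s: "(\<lambda>k. cinner f (F k) * cinner (G k) f) sums complex_of_real s"
      "A * (norm f)\<^sup>2 \<le> s"
      using A(2) by blast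
    have "cinner (e k) (V f) = cinner (G k) f" for k
      unfolding V_def by (metis cinner_analysis_op_basis[OF e G] cinner_commute)
    hence "(\<lambda>k. cinner f (F k) * cinner (G k) f) sums cinner (U f) (V f)"
      using cinner_analysis_op_sums[OF e F, of f "V f"] by (simp add: U_def)
    moreover have "cinner (U f) (V f) = cinner (Q f) f"
      by (metis Q_def cinner_cadjoint[OF e V] cinner_commute comp_apply)
    ultimately show ?thesis
      using s sums_unique2 by metis
  qed
  interpret pos_bounded_below_op Q
  proof
    show "pos_bounded_below Q"
    proof (rule pos_bounded_belowI[OF _ _ A(1)])
      show "bounded_clinear Q"
        unfolding Q_def by (intro bounded_clinear_comp U V')
      fix f
      obtain s where s: "cinner (Q f) f = complex_of_real s" "A * (norm f)\<^sup>2 \<le> s"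
        using form by blast
      moreover have "0 \<le> A * (norm f)\<^sup>2"
        using A(1) by simp
      ultimately show "cinner (Q f) f \<in> \<real>\<^sub>\<ge>\<^sub>0" "A * (norm f)\<^sup>2 \<le> Re (cinner (Q f) f)"
        by auto
    qed
  qed
  define W where "W = op_powr Q (- r) \<circ> cadjoint U"
  define T where "T = op_powr Q (- t) \<circ> cadjoint V"
  \<comment> \<open>Taking adjoints reverses the factors, and the power of \<open>Q\<close> is
    symmetric.\<close>
  have "cadjoint W = U \<circ> op_powr Q (- r)"
  proof (rule cadjoint_eqI)
    show "cinner (W x) y = cinner x ((U \<circ> op_powr Q (- r)) y)" for x y
      unfolding W_def comp_apply symmetric_op_powr
      by (metis cinner_cadjoint[OF e U] cinner_commute)
  qed
  moreover have "T (U (op_powr Q (- r) x)) = x" for x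
  proof -
    have "T (U (op_powr Q (- r) x)) = op_powr Q (- t) (op_powr Q 1 (op_powr Q (- r) x))"
      by (simp add: T_def op_powr_1) (simp add: Q_def)
    also have "\<dots> = op_powr Q (- t + (1 + - r)) x"
      by (simp only: op_powr_add)
    also have "- t + (1 + - r) = 0"
      using rt by simp
    finally show ?thesis by (simp add: op_powr_0)
  qed
  \<comment> \<open>The powers \<open>r\<close> and \<open>- r\<close> cancel, and synthesis returns
    \<open>F k\<close>.\<close>
  moreover have "F k = op_powr Q r (W (e k))" for k
    using op_powr_add[of r "- r"]
    by (simp add: W_def op_powr_0 U_def cadjoint_analysis_op_basis[OF e F])
  moreover have "G k = op_powr Q t (T (e k))" for k
    using op_powr_add[of t "- t"]
    by (simp add: T_def op_powr_0 V_def cadjoint_analysis_op_basis[OF e G])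
  moreover have "bounded_clinear T" "bounded_clinear W"
    unfolding T_def W_def by (intro bounded_clinear_comp bounded_clinear_op_powr U' V')+
  ultimately show ?thesis
    by (intro exI[of _ Q] exI[of _ T] exI[of _ W]) (auto simp: pos_bounded_below fun_eq_iff)
qed

lemma factorization_imp_biframe:
  fixes e F G :: "nat \<Rightarrow> 'a::chilbert_space" and Q T W :: "'a \<Rightarrow> 'a"
  assumes e: "orthonormal_basis e" and rt: "r + t = 1"
    and Q: "pos_bounded_below Q" and T: "bounded_clinear T" and W: "bounded_clinear W"
    and TW: "T \<circ> cadjoint W = id"
    and F: "\<And>k. F k = op_powr Q r (W (e k))" and G: "\<And>k. G k = op_powr Q t (T (e k))"
  shows "biframe F G"
proof -
  interpret pos_bounded_below_op Q by unfold_locales (rule Q)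
  obtain A where A: "A > 0" "\<And>x. A * (norm x)\<^sup>2 \<le> Re (cinner (Q x) x)"
    using coercive by blast
  obtain B where B: "B > 0" "\<And>x. Re (cinner (Q x) x) \<le> B * (norm x)\<^sup>2"
    using bounded_form by blast
  have "(\<lambda>k. cinner f (F k) * cinner (G k) f) sums complex_of_real (Re (cinner (Q f) f))" for f
  proof -
    \<comment> \<open>The two factors of the biframe series are the basis coordinates of
      \<open>u\<close> and the conjugated ones of \<open>v\<close>, so Parseval sums it.\<close>
    define u where "u = cadjoint W (op_powr Q r f)"
    define v where "v = cadjoint T (op_powr Q t f)"
    have "cinner f (F k) = cinner u (e k)" for k
      unfolding F u_def
      by (metis cinner_cadjoint[OF e W] cinner_commute symmetric_op_powr)
    moreover have "cinner (G k) f = cinner (e k) v" for k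
      unfolding G v_def symmetric_op_powr cinner_cadjoint[OF e T] ..
    ultimately have "(\<lambda>k. cinner f (F k) * cinner (G k) f) sums cinner u v"
      using Parseval[OF e, of u v] by simp
    moreover have "cinner u v = cinner (Q f) f"
    proof -
      \<comment> \<open>Moving \<open>T\<close> back to the left produces
        \<open>T \<circ> cadjoint W\<close>, which is the identity.\<close>
      have "cinner u v = cinner (T u) (op_powr Q t f)"
        by (simp add: v_def cinner_cadjoint[OF e T])
      also have "T u = op_powr Q r f"
        using TW by (simp add: u_def fun_eq_iff)
      also have "cinner (op_powr Q r f) (op_powr Q t f) = cinner (op_powr Q (t + r) f) f"
        by (simp add: op_powr_add symmetric_op_powr)
      also have "t + r = 1" using rt by simp
      finally show ?thesis by (simp add: op_powr_1)
    qed
    \<comment> \<open>\<open>biframe\<close> asks for a real sum, which is the real form of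
      \<open>Q\<close>; its bounds \<open>A\<close> and \<open>B\<close> are the biframe
      bounds.\<close>
    moreover have "complex_of_real (Re (cinner (Q f) f)) = cinner (Q f) f"
      using cinner_real[of f] by simp
    ultimately show ?thesis by simp
  qed
  thus ?thesis
    unfolding biframe_def using A B by blast
qed

theorem theorem5p1:
  fixes e F G :: "nat \<Rightarrow> 'a::chilbert_space" and r t :: real
  assumes "separable_space (euclidean :: 'a topology)"
    and "orthonormal_basis e"
    and "r + t = 1"
    and "bessel_sequence F" and "bessel_sequence G"
  shows "biframe F G \<longleftrightarrow>
    (\<exists>Q T W :: 'a \<Rightarrow> 'a.
       pos_bounded_below Q \<and> bounded_clinear T \<and> bounded_clinear W \<and>
       T \<circ> cadjoint W = id \<and>
       (\<forall>k. F k = op_powr Q r (W (e k)) \<and> G k = op_powr Q t (T (e k))))"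
proof
  assume "biframe F G"
  with assms(2-5) show "\<exists>Q T W :: 'a \<Rightarrow> 'a.
       pos_bounded_below Q \<and> bounded_clinear T \<and> bounded_clinear W \<and>
       T \<circ> cadjoint W = id \<and>
       (\<forall>k. F k = op_powr Q r (W (e k)) \<and> G k = op_powr Q t (T (e k)))"
    by (rule biframe_imp_factorization)
qed (use factorization_imp_biframe[OF assms(2,3)] in blast)

end
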